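(* There is a polynomial-time algorithm that, given a connected graph $G$ with a fixed vertex $\top$ and a pair $X,Y$ of acyclic $c$-orientations of $G$ (for the same $c$), outputs a shortest vertex flip sequence transforming $X$ into $Y$.
   Context: Graphs are finite and undirected. For a graph $G$, fix for each cycle $C$ of $G$ an arbitrary direction of traversal. Given an assignment $c$ of a number $c(C)\in\mathbb{N}_0$ to each cycle $C$ of $G$, a $c$-orientation of $G$ is an orientation of the edges of $G$ having, for every cycle $C$ of $G$, exactly $c(C)$ edges of $C$ oriented in forward direction. Thus $X,Y$ are $c$-orientations for a common $c$ if and only if each cycle of $G$ has equally many forward edges in $X$ and in $Y$. An orientation is acyclic if it has no directed cycle. A vertex flip (with respect to the fixed vertex $\top$) in an orientation consists of choosing a vertex $v\neq\top$ that is a source or a sink of the current orientation and reversing all edges incident to $v$; this again yields a $c$-orientation. A vertex flip sequence transforming $X$ into $Y$ is a sequence of successive vertex flips starting at $X$ and ending at $Y$; its length is the number of flips, and a shortest one is one of minimum length. *)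

theory Defs
  imports
    "Graph_Theory.Graph_Theory"
    "HOL-Library.Log_Nat"
    "HOL-Computational_Algebra.Polynomial"
begin

section \<open>Graphs, orientations and vertex flips\<close>

text \<open>
  The vertices are the numbers below \<open>nverts G\<close>; the edges are the positions in the list
  \<open>edges G\<close>, whose entries are the pairs of end vertices. Parallel edges and loops are allowed
  (a graph with a loop has no acyclic orientation). The order of the two ends in an entry has no
  meaning beyond providing names for the two possible orientations of the edge.
\<close>

record mgraph =
  nverts :: nat
  edges :: "(nat \<times> nat) list"

definition wf_mgraph :: "mgraph \<Rightarrow> bool" where
  "wf_mgraph G \<longleftrightarrow> (\<forall>(u, v) \<in> set (edges G). u < nverts G \<and> v < nverts G)"

text \<open>
  A dart \<open>(e, b)\<close> is the edge \<open>e\<close> together with one of its two directions: from the first to the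
  second component of \<open>edges G ! e\<close> if \<open>b\<close>, the opposite direction otherwise.
\<close>

type_synonym dart = "nat \<times> bool"

fun dart_tail :: "mgraph \<Rightarrow> dart \<Rightarrow> nat" where
  "dart_tail G (e, b) = (if b then fst (edges G ! e) else snd (edges G ! e))"

fun dart_head :: "mgraph \<Rightarrow> dart \<Rightarrow> nat" where
  "dart_head G (e, b) = dart_tail G (e, \<not> b)"

definition dart_digraph :: "mgraph \<Rightarrow> (nat, dart) pre_digraph" where
  "dart_digraph G = \<lparr> verts = {..<nverts G}, arcs = {..<length (edges G)} \<times> UNIV,
     tail = dart_tail G, head = dart_head G \<rparr>"

definition connected_mgraph :: "mgraph \<Rightarrow> bool" where
  "connected_mgraph G \<longleftrightarrow> strongly_connected (dart_digraph G)"

text \<open>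
  A cycle is identified with its set of edges, a direction of traversal with a corresponding list
  of darts. The distinctness condition excludes going back and forth along a single edge, which
  would be a cycle of length two in the dart digraph.
\<close>

definition cycle_traversal :: "mgraph \<Rightarrow> dart list \<Rightarrow> bool" where
  "cycle_traversal G p \<longleftrightarrow> pre_digraph.cycle (dart_digraph G) p \<and> distinct (map fst p)"

definition mgraph_cycles :: "mgraph \<Rightarrow> nat set set" where
  "mgraph_cycles G = {fst ` set p | p. cycle_traversal G p}"

definition cycle_directions :: "mgraph \<Rightarrow> (nat set \<Rightarrow> dart list) \<Rightarrow> bool" where
  "cycle_directions G dir \<longleftrightarrow>
     (\<forall>C \<in> mgraph_cycles G. cycle_traversal G (dir C) \<and> fst ` set (dir C) = C)"

text \<open>An orientation selects the dart \<open>(e, X ! e)\<close> for each edge \<open>e\<close>.\<close>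

type_synonym orientation = "bool list"

definition is_orientation :: "mgraph \<Rightarrow> orientation \<Rightarrow> bool" where
  "is_orientation G X \<longleftrightarrow> length X = length (edges G)"

definition oriented :: "mgraph \<Rightarrow> orientation \<Rightarrow> (nat, nat) pre_digraph" where
  "oriented G X = \<lparr> verts = {..<nverts G}, arcs = {..<length (edges G)},
     tail = (\<lambda>e. dart_tail G (e, X ! e)), head = (\<lambda>e. dart_head G (e, X ! e)) \<rparr>"

definition acyclic_orientation :: "mgraph \<Rightarrow> orientation \<Rightarrow> bool" where
  "acyclic_orientation G X \<longleftrightarrow>
     is_orientation G X \<and> (\<nexists>p. pre_digraph.cycle (oriented G X) p)"

definition forward_edges :: "orientation \<Rightarrow> dart list \<Rightarrow> nat set" where
  "forward_edges X p = {e. (e, X ! e) \<in> set p}"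

definition c_orientation ::
  "mgraph \<Rightarrow> (nat set \<Rightarrow> dart list) \<Rightarrow> (nat set \<Rightarrow> nat) \<Rightarrow> orientation \<Rightarrow> bool" where
  "c_orientation G dir c X \<longleftrightarrow>
     is_orientation G X \<and> (\<forall>C \<in> mgraph_cycles G. card (forward_edges X (dir C)) = c C)"

definition is_source :: "mgraph \<Rightarrow> orientation \<Rightarrow> nat \<Rightarrow> bool" where
  "is_source G X v \<longleftrightarrow> v < nverts G \<and> in_arcs (oriented G X) v = {}"

definition is_sink :: "mgraph \<Rightarrow> orientation \<Rightarrow> nat \<Rightarrow> bool" where
  "is_sink G X v \<longleftrightarrow> v < nverts G \<and> out_arcs (oriented G X) v = {}"

definition reverse_at :: "mgraph \<Rightarrow> nat \<Rightarrow> orientation \<Rightarrow> orientation" where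
  "reverse_at G v X = map2 (\<lambda>(a, b) x. if v = a \<or> v = b then \<not> x else x) (edges G) X"

text \<open>A flip sequence is given by the list of flipped vertices.\<close>

fun flip_sequence ::
  "mgraph \<Rightarrow> nat \<Rightarrow> orientation \<Rightarrow> nat list \<Rightarrow> orientation \<Rightarrow> bool" where
  "flip_sequence G vtop X [] Y \<longleftrightarrow> X = Y"
| "flip_sequence G vtop X (v # vs) Y \<longleftrightarrow>
     v \<noteq> vtop \<and> (is_source G X v \<or> is_sink G X v) \<and> flip_sequence G vtop (reverse_at G v X) vs Y"

definition shortest_flip_sequence ::
  "mgraph \<Rightarrow> nat \<Rightarrow> orientation \<Rightarrow> nat list \<Rightarrow> orientation \<Rightarrow> bool" where
  "shortest_flip_sequence G vtop X vs Y \<longleftrightarrow>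
     flip_sequence G vtop X vs Y \<and> (\<forall>ws. flip_sequence G vtop X ws Y \<longrightarrow> length vs \<le> length ws)"


section \<open>Random access machine programs and their running time\<close>

text \<open>
  The machine model is the random access machine of Cook and Reckhow (Time bounded random access
  machines, 1973), with natural numbers (and truncated subtraction) in place of integers and with
  conditionals and loops in place of jumps. Every executed instruction and every test costs one
  unit. Since one instruction makes the largest number in memory at most one bit longer, running
  times polynomial in the bit length of the input are the same as for Turing machines.
\<close>

datatype ram_prog =
    Skip
  | Const nat nat             \<comment> \<open>\<open>Const i k\<close>: \<open>M[i] := k\<close>\<close>
  | Add nat nat nat           \<comment> \<open>\<open>Add i j k\<close>: \<open>M[i] := M[j] + M[k]\<close>\<close>
  | Sub nat nat nat           \<comment> \<open>\<open>Sub i j k\<close>: \<open>M[i] := M[j] - M[k]\<close>\<close>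
  | Load nat nat              \<comment> \<open>\<open>Load i j\<close>: \<open>M[i] := M[M[j]]\<close>\<close>
  | Store nat nat             \<comment> \<open>\<open>Store i j\<close>: \<open>M[M[i]] := M[j]\<close>\<close>
  | Read nat                  \<comment> \<open>next input number, 0 if the input is exhausted\<close>
  | Print nat
  | Seq ram_prog ram_prog
  | IfNZ nat ram_prog ram_prog
  | WhileNZ nat ram_prog

record ram_state =
  mem :: "nat \<Rightarrow> nat"
  inp :: "nat list"
  outp :: "nat list"

definition set_mem :: "nat \<Rightarrow> nat \<Rightarrow> ram_state \<Rightarrow> ram_state" where
  "set_mem i x s = s\<lparr>mem := (mem s)(i := x)\<rparr>"

text \<open>\<open>ram_exec P s t s'\<close>: started in state \<open>s\<close>, program \<open>P\<close> halts in state \<open>s'\<close> after \<open>t\<close> steps.\<close>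

inductive ram_exec :: "ram_prog \<Rightarrow> ram_state \<Rightarrow> nat \<Rightarrow> ram_state \<Rightarrow> bool" where
  Skip: "ram_exec Skip s 1 s"
| Const: "ram_exec (Const i k) s 1 (set_mem i k s)"
| Add: "ram_exec (Add i j k) s 1 (set_mem i (mem s j + mem s k) s)"
| Sub: "ram_exec (Sub i j k) s 1 (set_mem i (mem s j - mem s k) s)"
| Load: "ram_exec (Load i j) s 1 (set_mem i (mem s (mem s j)) s)"
| Store: "ram_exec (Store i j) s 1 (set_mem (mem s i) (mem s j) s)"
| Read: "ram_exec (Read i) s 1
     (set_mem i (case inp s of [] \<Rightarrow> 0 | x # _ \<Rightarrow> x) (s\<lparr>inp := tl (inp s)\<rparr>))"
| Print: "ram_exec (Print i) s 1 (s\<lparr>outp := outp s @ [mem s i]\<rparr>)"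
| Seq: "ram_exec P s t s' \<Longrightarrow> ram_exec Q s' t' s'' \<Longrightarrow> ram_exec (Seq P Q) s (t + t') s''"
| IfTrue: "mem s i \<noteq> 0 \<Longrightarrow> ram_exec P s t s' \<Longrightarrow> ram_exec (IfNZ i P Q) s (1 + t) s'"
| IfFalse: "mem s i = 0 \<Longrightarrow> ram_exec Q s t s' \<Longrightarrow> ram_exec (IfNZ i P Q) s (1 + t) s'"
| WhileTrue: "mem s i \<noteq> 0 \<Longrightarrow> ram_exec P s t s' \<Longrightarrow> ram_exec (WhileNZ i P) s' t' s''
     \<Longrightarrow> ram_exec (WhileNZ i P) s (1 + t + t') s''"
| WhileFalse: "mem s i = 0 \<Longrightarrow> ram_exec (WhileNZ i P) s 1 s"

inductive_cases ram_exec_elims: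
  "ram_exec Skip s t s'"
  "ram_exec (Const i k) s t s'"
  "ram_exec (Add i j k) s t s'"
  "ram_exec (Sub i j k) s t s'"
  "ram_exec (Load i j) s t s'"
  "ram_exec (Store i j) s t s'"
  "ram_exec (Read i) s t s'"
  "ram_exec (Print i) s t s'"
  "ram_exec (Seq P Q) s t s'"
  "ram_exec (IfNZ i P Q) s t s'"
  "ram_exec (WhileNZ i P) s t s'"

lemma ram_exec_deterministic:
  "ram_exec P s t s' \<Longrightarrow> ram_exec P s u s'' \<Longrightarrow> u = t \<and> s'' = s'"
proof (induction arbitrary: u s'' rule: ram_exec.induct)
  case (Seq P s t s' Q t' s'')
  from Seq.prems obtain v w r where "u = v + w" "ram_exec P s v r" "ram_exec Q r w s''"
    by (rule ram_exec_elims(9))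
  moreover from this Seq.IH(1) have "v = t" "r = s'" by blast+
  ultimately show ?case using Seq.IH(2) by blast
next
  case (IfTrue s i P t s' Q)
  from IfTrue.prems show ?case
    by (rule ram_exec_elims(10)) (use IfTrue.hyps(1) IfTrue.IH in auto)
next
  case (IfFalse s i Q t s' P)
  from IfFalse.prems show ?case
    by (rule ram_exec_elims(10)) (use IfFalse.hyps(1) IfFalse.IH in auto)
next
  case (WhileTrue s i P t s' t' s'')
  from WhileTrue.prems WhileTrue.hyps(1) obtain v w r
    where "u = 1 + v + w" "ram_exec P s v r" "ram_exec (WhileNZ i P) r w s''"
    by (auto elim: ram_exec_elims(11))
  moreover from this WhileTrue.IH(1) have "v = t" "r = s'" by blast+
  ultimately show ?case using WhileTrue.IH(2) by blast
next
  case (WhileFalse s i P)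
  from WhileFalse.prems show ?case
    by (rule ram_exec_elims(11)) (use WhileFalse.hyps in auto)
qed (erule ram_exec_elims; simp)+

definition ram_computes :: "ram_prog \<Rightarrow> nat list \<Rightarrow> nat \<Rightarrow> nat list \<Rightarrow> bool" where
  "ram_computes P xs t ys \<longleftrightarrow>
     (\<exists>s. ram_exec P \<lparr>mem = (\<lambda>_. 0), inp = xs, outp = []\<rparr> t s \<and> outp s = ys)"

text \<open>Every number of the input contributes its binary digits and one separator.\<close>

definition input_size :: "nat list \<Rightarrow> nat" where
  "input_size xs = (\<Sum>x\<leftarrow>xs. floorlog 2 x + 1)"

definition encode_instance :: "mgraph \<Rightarrow> nat \<Rightarrow> orientation \<Rightarrow> orientation \<Rightarrow> nat list" where
  "encode_instance G vtop X Y =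
     [nverts G, length (edges G), vtop] @ concat (map (\<lambda>(u, v). [u, v]) (edges G)) @
     map of_bool X @ map of_bool Y"

end

(*
  Since X and Y have equally many forward edges on every cycle, the difference Y - X sums to 0 along
  every closed walk, so it is the coboundary of an integer potential z that vanishes at the fixed
  vertex; by connectedness z is unique, and |z v| is less than the number of vertices. Flipping a
  source v lowers z v by one, flipping a sink raises it by one, so every flip sequence has length at
  least the sum of all |z v|. Conversely, if z takes a positive value, then all edges leaving the
  set where z is maximal point outwards, and acyclicity yields a source in this set, which is a
  source of the whole graph; dually for negative values. Hence greedily flipping sources with
  z v > 0 and sinks with z v < 0 reaches Y in exactly the sum of all |z v| steps. The potential is
  computed by propagating it from the fixed vertex along the edges.
*)

theory Submission
  imports Defs
begin

section \<open>Gain of closed walks\<close>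

text \<open>The hypothesis on \<open>c\<close> concerns cycles only, each in one fixed direction,
  whereas a potential needs gain 0 on every closed walk. Two facts bridge this gap: traversals of
  the same edge set agree up to reversal, and a closed walk that repeats a vertex or an edge falls
  apart into shorter ones, an edge passed back and forth cancelling. Acyclicity has to survive each
  flip; it is therefore replaced by a ranking of the vertices that increases along all arcs, which
  is easily adapted to a flip. The running time has an obstacle of its own: the number n of vertices
  is written in binary, so loops of length n are polynomial in the input size only because
  connectedness bounds n by 2 m + 1, where m is the number of edges. The machine has natural numbers
  only, so the potential is stored shifted by n; since its values exceed -n, the stored ones are
  positive, and 0 is free to mark vertices not yet reached.\<close>

lemma dart_digraph_simps [simp]:
  "verts (dart_digraph G) = {..<nverts G}"
  "arcs (dart_digraph G) = {..<length (edges G)} \<times> UNIV"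
  "tail (dart_digraph G) = dart_tail G"
  "head (dart_digraph G) = dart_head G"
  by (simp_all add: dart_digraph_def)

lemma oriented_simps [simp]:
  "verts (oriented G X) = {..<nverts G}"
  "arcs (oriented G X) = {..<length (edges G)}"
  "tail (oriented G X) e = dart_tail G (e, X ! e)"
  "head (oriented G X) e = dart_head G (e, X ! e)"
  by (simp_all add: oriented_def)

lemma wf_mgraph_edge:
  assumes "wf_mgraph G" "e < length (edges G)"
  shows "fst (edges G ! e) < nverts G" "snd (edges G ! e) < nverts G"
  using assms(1) nth_mem[OF assms(2)] unfolding wf_mgraph_def by (simp_all add: case_prod_beta)

lemma fin_digraph_dart_digraph:
  assumes "wf_mgraph G"
  shows "fin_digraph (dart_digraph G)"
  by unfold_locales (auto simp: wf_mgraph_edge[OF assms])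

lemma fin_digraph_oriented:
  assumes "wf_mgraph G"
  shows "fin_digraph (oriented G X)"
  by unfold_locales (auto simp: wf_mgraph_edge[OF assms])

fun rev_dart :: "dart \<Rightarrow> dart" where
  "rev_dart (e, b) = (e, \<not> b)"

lemma rev_dart_simps [simp]:
  "fst (rev_dart d) = fst d" "rev_dart (rev_dart d) = d" "rev_dart d \<noteq> d"
  "dart_tail G (rev_dart d) = dart_head G d" "dart_head G (rev_dart d) = dart_tail G d"
  by (cases d; simp)+

lemma rev_dart_inject [simp]: "rev_dart d = rev_dart d' \<longleftrightarrow> d = d'"
  by (metis rev_dart_simps(2))

lemma fst_eq_dart: "fst d = fst d' \<Longrightarrow> d' = d \<or> d' = rev_dart d"
  by (cases d; cases d') auto

text \<open>A 1-cochain: the change from \<open>X\<close> to \<open>Y\<close> of the indicator that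
  the dart agrees with the orientation. Reversing the dart negates it, so going back and forth along
  an edge gains nothing.\<close>

definition dart_gain :: "orientation \<Rightarrow> orientation \<Rightarrow> dart \<Rightarrow> int" where
  "dart_gain X Y d = of_bool (Y ! fst d = snd d) - of_bool (X ! fst d = snd d)"

abbreviation walk_gain :: "orientation \<Rightarrow> orientation \<Rightarrow> dart list \<Rightarrow> int" where
  "walk_gain X Y p \<equiv> (\<Sum>d\<leftarrow>p. dart_gain X Y d)"

lemma dart_gain_rev_dart [simp]: "dart_gain X Y (rev_dart d) = - dart_gain X Y d"
  by (cases d) (auto simp: dart_gain_def)

lemma abs_dart_gain_le: "\<bar>dart_gain X Y d\<bar> \<le> 1"
  by (auto simp: dart_gain_def)

text \<open>\<open>forward_edges\<close> counts edges, the walk counts occurrences of darts; on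
  distinct edges the two agree.\<close>

lemma walk_gain_eq_card_forward_edges:
  assumes "distinct (map fst p)"
  shows "walk_gain X Y p = int (card (forward_edges Y p)) - int (card (forward_edges X p))"
proof -
  have "(\<Sum>d\<leftarrow>p. of_bool (Z ! fst d = snd d)) = int (card (forward_edges Z p))" for Z :: orientation
  proof -
    have "forward_edges Z p = fst ` (set p \<inter> {d. Z ! fst d = snd d})"
      by (force simp: forward_edges_def)
    moreover have "inj_on fst (set p \<inter> {d. Z ! fst d = snd d})"
      using assms by (auto simp: distinct_map intro: inj_on_subset)
    ultimately have "card (forward_edges Z p) = card (set p \<inter> {d. Z ! fst d = snd d})"
      by (simp add: card_image)
    then show ?thesis
      using assms by (simp add: sum_list_distinct_conv_sum_set distinct_map)
  qed
  from this[of Y] this[of X] show ?thesis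
    by (simp add: dart_gain_def sum_list_subtractf)
qed

section \<open>Closed walks and the two traversals of a cycle\<close>

lemma (in pre_digraph) cas_head_last: "cas u p v \<Longrightarrow> p \<noteq> [] \<Longrightarrow> head G (last p) = v"
  by (induction p arbitrary: u) (auto split: if_splits)

text \<open>On a closed walk each dart ends where the cyclically next one starts. This carries
  distinctness from heads to tails.\<close>

lemma (in pre_digraph) cas_closed_heads:
  assumes "cas u p u" "p \<noteq> []"
  shows "map (head G) p = rotate1 (map (tail G) p)"
proof -
  have "map (tail G) p @ [u] = u # map (head G) p"
    using assms awalk_verts_conv[of u p] awalk_verts_conv'[OF assms(1)] cas_head_last[OF assms]
    by (cases p) auto
  then show ?thesis using assms by (cases p) auto
qed

text \<open>The step hypothesis ranges over all darts of \<open>p\<close> that meet head to tail,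
  not only consecutive ones, which avoids indices.\<close>

lemma (in pre_digraph) cas_propagate:
  assumes "cas u p v"
    and "\<And>d. d \<in> set p \<Longrightarrow> tail G d = u \<Longrightarrow> P d"
    and "\<And>d d'. d \<in> set p \<Longrightarrow> d' \<in> set p \<Longrightarrow> head G d = tail G d' \<Longrightarrow> P d \<Longrightarrow> P d'"
    and "d \<in> set p"
  shows "P d"
  using assms
proof (induction p arbitrary: u d)
  case (Cons a p)
  have a: "P a" using Cons.prems by auto
  show ?case
  proof (cases "d = a")
    case False
    show ?thesis
    proof (rule Cons.IH[of "head G a"])
      show "cas (head G a) p v" using Cons.prems(1) by simp
      show "P d'" if "d' \<in> set p" "tail G d' = head G a" for d'
        using Cons.prems(3)[of a d'] that a by simp
      show "P d2" if "d1 \<in> set p" "d2 \<in> set p" "head G d1 = tail G d2" "P d1" for d1 d2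
        using Cons.prems(3)[of d1 d2] that by simp
      show "d \<in> set p" using False Cons.prems(4) by simp
    qed
  qed (use a in simp)
qed simp

text \<open>A closed walk may be entered at any dart \<open>a\<close>: from \<open>a\<close> the
  property runs to \<open>last p\<close>, whose head is \<open>u\<close>, and from there through all
  of \<open>p\<close>, starting at its beginning.\<close>

lemma (in pre_digraph) cas_closed_propagate:
  assumes "cas u p u"
    and step: "\<And>d d'. d \<in> set p \<Longrightarrow> d' \<in> set p \<Longrightarrow> head G d = tail G d' \<Longrightarrow> P d \<Longrightarrow> P d'"
    and "a \<in> set p" "P a" "d \<in> set p"
  shows "P d"
proof -
  obtain p1 p2 where p: "p = p1 @ a # p2" using split_list[OF \<open>a \<in> set p\<close>] by blast
  have c2: "cas (head G a) p2 u" using assms(1) by (simp add: p)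
  have P2: "P d" if "d \<in> set p2" for d
    by (rule cas_propagate[OF c2 _ _ that]) (use step[of a] step assms(4) in \<open>auto simp: p\<close>)
  have hl: "head G (last p) = u"
    using cas_head_last[OF assms(1)] by (simp add: p)
  have Pl: "P (last p)" using P2 assms(4) by (simp add: p)
  show ?thesis
  proof (rule cas_propagate[OF assms(1) _ _ assms(5)])
    have "last p \<in> set p" by (simp add: p)
    then show "P d" if "d \<in> set p" "tail G d = u" for d
      using step[of "last p" d] that Pl hl by simp
  qed (rule step)
qed

text \<open>\<open>cycle\<close> requires \<open>tl (awalk_verts u p)\<close> to be distinct, which
  is the list of heads; the tails are a rotation of it.\<close>

lemma cycle_traversalE:
  assumes "cycle_traversal G p"
  obtains u where "pre_digraph.cas (dart_digraph G) u p u" "p \<noteq> []" "distinct p" "distinct (map fst p)"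
    "inj_on (dart_tail G) (set p)" "inj_on (dart_head G) (set p)" "set p \<subseteq> {..<length (edges G)} \<times> UNIV"
proof -
  interpret pre_digraph "dart_digraph G" .
  from assms obtain u where u: "awalk u p u" "distinct (tl (awalk_verts u p))" "p \<noteq> []" "distinct (map fst p)"
    by (auto simp: cycle_traversal_def cycle_def)
  then have c: "cas u p u" by (simp add: awalk_def)
  have "distinct (map (dart_head G) p)"
    using u awalk_verts_conv'[OF c] by auto
  moreover have "distinct (map (dart_tail G) p)"
    using cas_closed_heads[OF c u(3)] calculation by simp
  ultimately show thesis using that[of u] u c by (auto simp: distinct_map awalk_def)
qed

text \<open>A cycle traverses its edge set either along or against any other cycle with the same
  edges: at a common dart, the next edge cannot be entered through its other end.\<close>

lemma cycle_traversal_same_edges_aux: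
  assumes p: "cycle_traversal G p" and Q: "inj_on (dart_head G) Q" "inj_on fst Q"
    and sub: "fst ` set p = fst ` Q"
    and a: "a \<in> set p" "a \<in> Q"
  shows "set p = Q"
proof -
  have inc: "set p \<subseteq> Q"
  proof
    fix d assume d: "d \<in> set p"
    from p obtain u where u: "pre_digraph.cas (dart_digraph G) u p u" "distinct (map fst p)"
      by (rule cycle_traversalE)
    show "d \<in> Q"
    proof (rule pre_digraph.cas_closed_propagate[OF u(1), where P = "\<lambda>d. d \<in> Q"])
      fix d1 d2 assume d12: "d1 \<in> set p" "d2 \<in> set p"
        "head (dart_digraph G) d1 = tail (dart_digraph G) d2" "d1 \<in> Q"
      show "d2 \<in> Q"
      proof (rule ccontr)
        assume "d2 \<notin> Q"
        moreover obtain d3 where "d3 \<in> Q" "fst d3 = fst d2" using sub d12(2) by (metis imageE imageI)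
        ultimately have r: "rev_dart d2 \<in> Q" using fst_eq_dart[of d2 d3] by auto
        \<comment> \<open>With \<open>rev_dart d2\<close> in \<open>Q\<close>, this dart and
          \<open>d1\<close> both belong to \<open>Q\<close> and enter the same vertex. They
          coincide, so \<open>d1\<close> and \<open>d2\<close> lie on one edge, which
          \<open>p\<close> uses only once.\<close>
        have "dart_head G (rev_dart d2) = dart_head G d1" using d12(3) by simp
        with Q(1) r d12(4) have *: "rev_dart d2 = d1" by (meson inj_onD)
        then have "fst d1 = fst d2" by auto
        with u(2) d12 have "d1 = d2" by (auto simp: distinct_map dest: inj_onD)
        with * show False by simp
      qed
    qed (use a d in auto)
  qed
  with Q(2) sub show ?thesis by (metis inj_on_image_eq_iff order_refl)
qed

text \<open>Orientations are compared along \<open>dir C\<close> alone, but a given traversal of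
  \<open>C\<close> may start elsewhere or run the other way. If \<open>a\<close> is not a dart of
  \<open>q\<close>, it becomes one after reversing all of \<open>q\<close>.\<close>

lemma cycle_traversal_same_edges:
  assumes p: "cycle_traversal G p" and q: "cycle_traversal G q" and eq: "fst ` set p = fst ` set q"
  shows "set p = set q \<or> set p = rev_dart ` set q"
proof -
  have "p \<noteq> []" by (rule cycle_traversalE[OF p])
  then obtain a where a: "a \<in> set p" using hd_in_set by blast
  have inj: "inj_on (dart_tail G) (set q)" "inj_on (dart_head G) (set q)" "inj_on fst (set q)"
    by (rule cycle_traversalE[OF q], assumption)+ (rule cycle_traversalE[OF q], simp only: distinct_map)

  from a eq obtain b where b: "b \<in> set q" "fst b = fst a" by (metis imageE imageI)
  show ?thesis
  proof (cases "a \<in> set q")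
    case True
    then show ?thesis using cycle_traversal_same_edges_aux[OF p inj(2,3) eq a] by simp
  next
    case False
    then have "a = rev_dart b" using b fst_eq_dart[of b a] by auto
    then have "a \<in> rev_dart ` set q" using b by simp
    moreover have "inj_on (dart_head G) (rev_dart ` set q)" "inj_on fst (rev_dart ` set q)"
      using inj by (simp_all add: inj_on_def)
    moreover have "fst ` set p = fst ` rev_dart ` set q"
      by (simp add: eq image_comp comp_def)
    ultimately show ?thesis
      using cycle_traversal_same_edges_aux[OF p, of "rev_dart ` set q" a] a by simp
  qed
qed

lemma walk_gain_cycle_traversal:
  assumes dir: "cycle_directions G dir" and X: "c_orientation G dir c X" and Y: "c_orientation G dir c Y"
    and p: "cycle_traversal G p"
  shows "walk_gain X Y p = 0"
proof -
  define q where "q = dir (fst ` set p)"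
  have C: "fst ` set p \<in> mgraph_cycles G" using p by (auto simp: mgraph_cycles_def)
  with dir have q: "cycle_traversal G q" "fst ` set q = fst ` set p"
    by (auto simp: cycle_directions_def q_def)
  have dp: "distinct p" and dq: "distinct q" "distinct (map fst q)"
    by (rule cycle_traversalE[OF p], simp) (rule cycle_traversalE[OF q(1)]; simp)+
  have "walk_gain X Y q = 0"
    using X Y C unfolding walk_gain_eq_card_forward_edges[OF dq(2)]
    by (simp add: c_orientation_def q_def)
  then have q0: "(\<Sum>d\<in>set q. dart_gain X Y d) = 0"
    by (simp add: sum_list_distinct_conv_sum_set dq)
  \<comment> \<open>Reversal only changes the sign of the sum, so the value 0 passes from
    \<open>q\<close> to \<open>p\<close> in both cases.\<close>
  have "(\<Sum>d\<in>set p. dart_gain X Y d) = 0"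
    using cycle_traversal_same_edges[OF p q(1) q(2)[symmetric]]
  proof
    assume "set p = rev_dart ` set q"
    moreover have "inj_on rev_dart (set q)" by (metis inj_onI rev_dart_simps(2))
    ultimately show ?thesis using q0 by (simp add: sum.reindex sum_negf)
  qed (use q0 in simp)
  then show ?thesis by (simp add: sum_list_distinct_conv_sum_set dp)
qed

text \<open>A nonempty closed walk that is not a cycle traversal repeats a vertex or an edge. A
  repeated vertex cuts out a closed walk, and so does an edge used twice in the same direction. If
  the directions are opposite, the two gains cancel, and both the stretch in between and the rest
  outside are closed. All pieces are shorter.\<close>

lemma walk_gain_closed:
  assumes wf: "wf_mgraph G"
    and cyc: "\<And>p. cycle_traversal G p \<Longrightarrow> walk_gain X Y p = 0"
    and "pre_digraph.awalk (dart_digraph G) u p u"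
  shows "walk_gain X Y p = 0"
  using assms(3)
proof (induction "length p" arbitrary: p u rule: less_induct)
  case less
  interpret fin_digraph "dart_digraph G" by (rule fin_digraph_dart_digraph[OF wf])
  have split: "walk_gain X Y (a @ b @ c) = 0"
    if "awalk u a w" "awalk w b w" "awalk w c u" "p = a @ b @ c" "a @ c \<noteq> []" "b \<noteq> []" for a b c w
  proof -
    have "length b < length p" "length (a @ c) < length p" using that(4-6) by auto
    moreover have "awalk u (a @ c) u" by (rule awalk_appendI[OF that(1,3)])
    ultimately have "walk_gain X Y b = 0" "walk_gain X Y (a @ c) = 0"
      using less.hyps that(2) by blast+
    then show ?thesis by simp
  qed
  consider "p = []" | "distinct (tl (awalk_verts u p))" "distinct (map fst p)" "p \<noteq> []"
    | "\<not> distinct (tl (awalk_verts u p))" "p \<noteq> []" | "\<not> distinct (map fst p)" by blast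
  then show ?case
  proof cases
    case 2
    then have "cycle_traversal G p" using less.prems by (auto simp: cycle_traversal_def cycle_def)
    then show ?thesis by (rule cyc)
  next
    case 3
    then obtain d r where p: "p = d # r" by (cases p) auto
    have r: "awalk (dart_head G d) r u" using less.prems unfolding p awalk_Cons_iff dart_digraph_simps by blast
    have d: "awalk u [d] (dart_head G d)" using less.prems awalk_hd_in_verts[OF r]
      unfolding p awalk_Cons_iff awalk_Nil_iff dart_digraph_simps by blast
    \<comment> \<open>The repetition is among the heads of \<open>p\<close>, which are the vertices
      of \<open>r\<close>; with \<open>d\<close> kept outside the loop \<open>b\<close>, both pieces
      are proper.\<close>
    have "\<not> distinct (awalk_verts (dart_head G d) r)" using 3 by (simp add: p)
    then obtain a b c w where abc: "r = a @ b @ c" "awalk (dart_head G d) a w" "awalk w b w" "awalk w c u" "b \<noteq> []"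
      using awalk_not_distinct_decomp[OF r] by blast
    have "awalk u (d # a) w" using awalk_appendI[OF d abc(2)] by simp
    from split[OF this abc(3,4)] abc show ?thesis by (simp add: p)
  next
    case 4
    then obtain y xs ys zs where y: "map fst p = xs @ [y] @ ys @ [y] @ zs"
      using not_distinct_decomp by blast
    then obtain a r where r: "p = a @ r" "map fst r = y # ys @ y # zs"
      unfolding map_eq_append_conv by auto
    then obtain d r' where r': "r = d # r'" "fst d = y" "map fst r' = ys @ y # zs" by auto
    then obtain m r'' where r'': "r' = m @ r''" "map fst r'' = y # zs"
      unfolding map_eq_append_conv by auto
    then obtain e b where "r'' = e # b" "fst e = y" by auto
    with r r' r'' have p: "p = a @ d # m @ e # b" and ij: "fst d = fst e" by auto
    obtain w where w: "awalk u a w" "awalk w (d # m @ e # b) u"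
      using less.prems unfolding p awalk_append_iff by blast
    from w(2) have w2: "d \<in> arcs (dart_digraph G)" "w = dart_tail G d" "awalk (dart_head G d) (m @ e # b) u"
      unfolding awalk_Cons_iff dart_digraph_simps by blast+
    from w2(3) obtain w' where "awalk (dart_head G d) m w'" "awalk w' (e # b) u"
      unfolding awalk_append_iff by blast
    then have w3: "awalk (dart_head G d) m (dart_tail G e)" "awalk (dart_head G e) b u" "e \<in> arcs (dart_digraph G)"
      unfolding awalk_Cons_iff dart_digraph_simps by blast+
    have de: "e = d \<or> e = rev_dart d" using ij fst_eq_dart by blast
    then show ?thesis
    proof
      assume e: "e = d"
      have "awalk w (d # m) w" using w2 w3(1) e unfolding awalk_Cons_iff by simp
      moreover have "awalk w (e # b) u" using w2 w3 e unfolding awalk_Cons_iff by simp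
      ultimately show ?thesis using split[OF w(1), of "d # m" "e # b"] by (simp add: p)
    next
      assume e: "e = rev_dart d"
      have m: "walk_gain X Y m = 0"
        using w3(1) e by (intro less.hyps[of _ "dart_head G d"]) (simp_all add: p)
      have "walk_gain X Y (a @ b) = 0"
        using w3(2) e w(1) w2(2)
        by (intro less.hyps[of _ u] awalk_appendI[of u a w]) (simp_all add: p)
      with m show ?thesis by (simp add: p e)
    qed
  qed simp
qed

section \<open>Potentials\<close>

definition potential :: "mgraph \<Rightarrow> orientation \<Rightarrow> orientation \<Rightarrow> (nat \<Rightarrow> int) \<Rightarrow> bool" where
  "potential G X Y z \<longleftrightarrow> (\<forall>e < length (edges G).
     of_bool (Y ! e) - of_bool (X ! e) = z (snd (edges G ! e)) - z (fst (edges G ! e)))"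

lemma potential_dart:
  assumes "potential G X Y z" "fst d < length (edges G)"
  shows "z (dart_head G d) - z (dart_tail G d) = dart_gain X Y d"
proof (cases d)
  case (Pair e b)
  with assms have "of_bool (Y ! e) - of_bool (X ! e) = z (snd (edges G ! e)) - z (fst (edges G ! e))"
    by (simp add: potential_def)
  then show ?thesis by (cases b) (auto simp: Pair dart_gain_def split: if_splits)
qed

lemma potential_walk:
  assumes "potential G X Y z" "pre_digraph.awalk (dart_digraph G) u p v"
  shows "walk_gain X Y p = z v - z u"
proof -
  interpret pre_digraph "dart_digraph G" .
  have "set p \<subseteq> {..<length (edges G)} \<times> UNIV" "cas u p v" using assms(2) by (auto simp: awalk_def)
  then show ?thesis
  proof (induction p arbitrary: u)
    case (Cons d p)
    then show ?case using potential_dart[OF assms(1), of d] by auto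
  qed simp
qed

lemma potential_unique:
  assumes "connected_mgraph G" "wf_mgraph G" "potential G X Y f" "potential G X Y g" "f r = g r"
    and "r < nverts G" "v < nverts G"
  shows "f v = g v"
proof -
  interpret fin_digraph "dart_digraph G" by (rule fin_digraph_dart_digraph[OF assms(2)])
  obtain p where "awalk r p v"
    using assms(1,6,7) reachable_awalk[of r v] by (auto simp: connected_mgraph_def strongly_connected_def)
  from potential_walk[OF assms(3) this] potential_walk[OF assms(4) this] assms(5) show ?thesis by simp
qed

lemma abs_walk_gain_le: "\<bar>walk_gain X Y p\<bar> \<le> int (length p)"
proof (induction p)
  case (Cons d p)
  then show ?case using abs_dart_gain_le[of X Y d] by (simp add: abs_le_iff)
qed simp

text \<open>The value at a vertex is the gain of any walk from \<open>r\<close>: two such walks are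
  closed up by the same return walk \<open>s\<close>, and both results have gain 0. The bound comes
  from evaluating along a path, which has fewer than \<open>nverts G\<close> darts, each of gain at
  most 1 in absolute value.\<close>

lemma potential_exists:
  assumes wf: "wf_mgraph G" and con: "connected_mgraph G" and r: "r < nverts G"
    and cyc: "\<And>p. cycle_traversal G p \<Longrightarrow> walk_gain X Y p = 0"
  obtains z where "potential G X Y z" "z r = 0" "\<And>v. v < nverts G \<Longrightarrow> \<bar>z v\<bar> < int (nverts G)"
proof -
  interpret fin_digraph "dart_digraph G" by (rule fin_digraph_dart_digraph[OF wf])
  have reach: "\<exists>p. awalk u p v" if "u < nverts G" "v < nverts G" for u v
    using con that reachable_awalk[of u v] by (auto simp: connected_mgraph_def strongly_connected_def)
  define P where "P v = (SOME p. awalk r p v)" for v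
  have P: "awalk r (P v) v" if "v < nverts G" for v
    unfolding P_def using reach[OF r that] by (rule someI_ex)
  define z where "z v = walk_gain X Y (P v)" for v
  have z: "walk_gain X Y q = z v" if q: "awalk r q v" and v: "v < nverts G" for q v
  proof -
    obtain s where s: "awalk v s r" using reach[OF v r] by blast
    have "walk_gain X Y (q @ s) = 0" "walk_gain X Y (P v @ s) = 0"
      by (rule walk_gain_closed[OF wf cyc], assumption, rule awalk_appendI[OF _ s], rule q P[OF v])+
    then show ?thesis by (simp add: z_def)
  qed
  have "potential G X Y z"
    unfolding potential_def
  proof (intro allI impI)
    fix e assume e: "e < length (edges G)"
    let ?u = "fst (edges G ! e)" and ?v = "snd (edges G ! e)"
    note uv = wf_mgraph_edge[OF wf e]
    have "awalk ?u [(e, True)] ?v" using e uv by (simp add: awalk_def)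
    from z[OF awalk_appendI[OF P[OF uv(1)] this] uv(2)] z_def[of ?u]
    show "of_bool (Y ! e) - of_bool (X ! e) = z ?v - z ?u" by (simp add: dart_gain_def)
  qed
  moreover have "z r = 0"
    unfolding z_def by (rule walk_gain_closed[OF wf cyc _], assumption, rule P[OF r])
  moreover have "\<bar>z v\<bar> < int (nverts G)" if v: "v < nverts G" for v
  proof -
    obtain q where q: "apath r q v" using reach[OF r v] reachable_awalk reachable_apath by blast
    have "\<bar>z v\<bar> \<le> int (length q)"
      using z[OF awalkI_apath[OF q] v] abs_walk_gain_le[of X Y q] by simp
    then show ?thesis using length_apath_less[OF q] by simp
  qed
  ultimately show thesis by (rule that)
qed

text \<open>A walk to vertex 0 shows that every other vertex is the tail of one of the twice
  \<open>length (edges G)\<close> darts. This crude bound suffices for the running time.\<close>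

lemma nverts_le_edges:
  assumes wf: "wf_mgraph G" and con: "connected_mgraph G"
  shows "nverts G \<le> 2 * length (edges G) + 1"
proof (cases "nverts G")
  case (Suc k)
  interpret fin_digraph "dart_digraph G" by (rule fin_digraph_dart_digraph[OF wf])
  let ?D = "{..<length (edges G)} \<times> (UNIV :: bool set)"
  have "v \<in> insert 0 (dart_tail G ` ?D)" if v: "v < nverts G" for v
  proof (cases "v = 0")
    case False
    obtain p where "awalk v p 0"
      using con v Suc reachable_awalk[of v 0] by (auto simp: connected_mgraph_def strongly_connected_def)
    with False obtain d p' where "awalk v (d # p') 0" by (cases p) (auto simp: awalk_Nil_iff)
    then have "v = dart_tail G d" "d \<in> ?D" unfolding awalk_Cons_iff by simp_all
    then show ?thesis by blast
  qed simp
  then have "{..<nverts G} \<subseteq> insert 0 (dart_tail G ` ?D)" by blast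
  moreover have fin: "finite ?D" by simp
  ultimately have "nverts G \<le> card (insert 0 (dart_tail G ` ?D))"
    using card_mono[of "insert 0 (dart_tail G ` ?D)" "{..<nverts G}"] by simp
  also have "\<dots> \<le> Suc (card (dart_tail G ` ?D))" using fin by (simp add: card_insert_if)
  also have "\<dots> \<le> Suc (card ?D)" using card_image_le[OF fin] by (rule Suc_le_mono[THEN iffD2])
  finally show ?thesis by (simp add: card_cartesian_product)
qed simp

section \<open>Vertex flips\<close>

text \<open>Acyclicity as a topological numbering. It is repaired after a flip by moving one vertex
  to an extreme, and its extremes on a set of vertices yield sources and sinks.\<close>

definition ranked :: "mgraph \<Rightarrow> orientation \<Rightarrow> bool" where
  "ranked G X \<longleftrightarrow> (\<exists>f :: nat \<Rightarrow> nat. \<forall>e < length (edges G).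
     f (dart_tail G (e, X ! e)) < f (dart_head G (e, X ! e)))"

text \<open>A vertex is ranked by the number of vertices from which a nonempty walk leads to it.
  Along an arc this set grows strictly: it acquires the tail, which lies on no nonempty closed
  walk.\<close>

lemma acyclic_orientation_ranked:
  assumes wf: "wf_mgraph G" and ac: "acyclic_orientation G X"
  shows "ranked G X"
proof -
  interpret fin_digraph "oriented G X" by (rule fin_digraph_oriented[OF wf])
  let ?R = "\<lambda>u v. \<exists>p. p \<noteq> [] \<and> awalk u p v"
  have irrefl: "\<not> ?R u u" for u
    using ac closed_w_imp_cycle by (auto simp: acyclic_orientation_def closed_w_def)
  have fin: "finite {u. ?R u v}" for v
    by (rule finite_subset[of _ "{..<nverts G}"]) (auto dest: awalk_hd_in_verts)
  define A where "A v = {u. ?R u v}" for v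
  have "card (A (tail (oriented G X) e)) < card (A (head (oriented G X) e))"
    if e: "e \<in> arcs (oriented G X)" for e
  proof (rule psubset_card_mono)
    let ?t = "tail (oriented G X) e" and ?h = "head (oriented G X) e"
    have e': "awalk ?t [e] ?h" by (rule arc_implies_awalk[OF e])
    have "A ?t \<subseteq> A ?h"
    proof
      fix u assume "u \<in> A ?t"
      then obtain p where "awalk u p ?t" unfolding A_def by blast
      from awalk_appendI[OF this e'] show "u \<in> A ?h" unfolding A_def by blast
    qed
    moreover have "?t \<in> A ?h" unfolding A_def using e' by blast
    moreover have "?t \<notin> A ?t" unfolding A_def using irrefl[of ?t] by simp
    ultimately show "A ?t \<subset> A ?h" by blast
  qed (simp add: A_def fin)
  then show ?thesis unfolding ranked_def oriented_simps by (intro exI[of _ "\<lambda>v. card (A v)"]) simp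
qed

lemma length_reverse_at [simp]: "length (reverse_at G v X) = min (length (edges G)) (length X)"
  by (simp add: reverse_at_def)

lemma nth_reverse_at:
  assumes "e < length (edges G)" "e < length X"
  shows "reverse_at G v X ! e = (X ! e \<noteq> (v = fst (edges G ! e) \<or> v = snd (edges G ! e)))"
  using assms by (auto simp: reverse_at_def split: prod.splits)

lemma is_source_iff:
  "is_source G X v \<longleftrightarrow> v < nverts G \<and> (\<forall>e < length (edges G). dart_head G (e, X ! e) \<noteq> v)"
  by (auto simp: is_source_def in_arcs_def)

lemma is_sink_iff:
  "is_sink G X v \<longleftrightarrow> v < nverts G \<and> (\<forall>e < length (edges G). dart_tail G (e, X ! e) \<noteq> v)"
  by (auto simp: is_sink_def out_arcs_def)

definition flippable :: "mgraph \<Rightarrow> orientation \<Rightarrow> bool \<Rightarrow> nat \<Rightarrow> bool" where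
  "flippable G X b v \<longleftrightarrow> (if b then is_source G X v else is_sink G X v)"

text \<open>All edges at a source leave it, so reversing them is the coboundary of the indicator of
  \<open>v\<close>; at a sink it is that of its negative.\<close>

lemma potential_flip:
  assumes "flippable G X b v" "length X = length (edges G)"
  shows "potential G X (reverse_at G v X) (\<lambda>u. if u = v then if b then 1 else - 1 else 0)"
  unfolding potential_def
proof (intro allI impI)
  fix e assume e: "e < length (edges G)"
  show "of_bool (reverse_at G v X ! e) - of_bool (X ! e) =
      (if snd (edges G ! e) = v then if b then 1 else - 1 else 0) -
      (if fst (edges G ! e) = v then if b then 1 else - (1 :: int) else 0)"
    using assms e
    by (cases "X ! e"; cases b) (auto simp: flippable_def is_source_iff is_sink_iff nth_reverse_at)
qed

lemma potential_trans:
  assumes "potential G X Y f" "potential G Y Z g"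
  shows "potential G X Z (\<lambda>v. f v + g v)"
  unfolding potential_def
proof (intro allI impI)
  fix e assume "e < length (edges G)"
  with assms[unfolded potential_def, rule_format, of e]
  show "of_bool (Z ! e) - of_bool (X ! e) =
      f (snd (edges G ! e)) + g (snd (edges G ! e)) - (f (fst (edges G ! e)) + g (fst (edges G ! e)))"
    by linarith
qed

lemma potential_diff:
  assumes "potential G X Y f" "potential G X Z g"
  shows "potential G Z Y (\<lambda>v. f v - g v)"
  unfolding potential_def
proof (intro allI impI)
  fix e assume "e < length (edges G)"
  with assms[unfolded potential_def, rule_format, of e]
  show "of_bool (Y ! e) - of_bool (Z ! e) =
      f (snd (edges G ! e)) - g (snd (edges G ! e)) - (f (fst (edges G ! e)) - g (fst (edges G ! e)))"
    by linarith
qed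

text \<open>Each flip contributes a signed indicator of a vertex other than \<open>r\<close>, and
  the triangle inequality bounds the sum of absolute values by the number of flips.\<close>

lemma flip_sequence_potential:
  assumes "flip_sequence G r X ws Y" "length X = length (edges G)"
  shows "\<exists>f. potential G X Y f \<and> f r = 0 \<and> (\<Sum>v<nverts G. \<bar>f v\<bar>) \<le> int (length ws)"
  using assms
proof (induction ws arbitrary: X)
  case Nil
  then show ?case by (intro exI[of _ "\<lambda>_. 0"]) (simp add: potential_def)
next
  case (Cons v ws)
  then obtain b where b: "flippable G X b v" 
    unfolding flippable_def flip_sequence.simps(2) by (metis (full_types))
  have v: "v \<noteq> r" "v < nverts G"
    using Cons.prems(1) by (auto simp: is_source_def is_sink_def)
  define s :: int where "s = (if b then 1 else - 1)"
  have fl: "potential G X (reverse_at G v X) (\<lambda>u. if u = v then s else 0)"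
    unfolding s_def by (rule potential_flip[OF b Cons.prems(2)])
  from Cons.prems Cons.IH[of "reverse_at G v X"] obtain f
    where f: "potential G (reverse_at G v X) Y f" "f r = 0" "(\<Sum>v<nverts G. \<bar>f v\<bar>) \<le> int (length ws)"
    by auto
  have "(\<Sum>u<nverts G. \<bar>(if u = v then s else 0) + f u\<bar>)
      \<le> (\<Sum>u<nverts G. (if u = v then 1 else 0) + \<bar>f u\<bar>)"
    by (rule sum_mono) (auto simp: s_def)
  also have "\<dots> = 1 + (\<Sum>u<nverts G. \<bar>f u\<bar>)" using v by (simp add: sum.distrib)
  finally show ?case
    using f v potential_trans[OF fl f(1)]
    by (intro exI[of _ "\<lambda>u. (if u = v then s else 0) + f u"] conjI) simp_all
qed

section \<open>Greedy flipping\<close>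

text \<open>A flipped source becomes a sink and may be ranked above everything; the successor of the
  sum of all ranks is large enough. A flipped sink becomes a source and gets rank 0, the other ranks
  moving up by one.\<close>

lemma ranked_reverse_at:
  assumes wf: "wf_mgraph G" and X: "length X = length (edges G)" and rk: "ranked G X"
    and v: "flippable G X b v"
  shows "ranked G (reverse_at G v X)"
proof -
  let ?X = "reverse_at G v X"
  from rk obtain f :: "nat \<Rightarrow> nat" where
    f: "\<And>e. e < length (edges G) \<Longrightarrow> f (dart_tail G (e, X ! e)) < f (dart_head G (e, X ! e))"
    by (auto simp: ranked_def)
  have away: "dart_tail G (e, ?X ! e) = dart_tail G (e, X ! e)" "dart_head G (e, ?X ! e) = dart_head G (e, X ! e)"
    if "e < length (edges G)" "dart_tail G (e, X ! e) \<noteq> v" "dart_head G (e, X ! e) \<noteq> v" for e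
    using that X by (auto simp: nth_reverse_at split: if_splits)
  have at: "dart_tail G (e, ?X ! e) = dart_head G (e, X ! e)" "dart_head G (e, ?X ! e) = dart_tail G (e, X ! e)"
    if "e < length (edges G)" "dart_tail G (e, X ! e) = v \<or> dart_head G (e, X ! e) = v" for e
    using that X by (auto simp: nth_reverse_at split: if_splits)
  have lt: "dart_tail G (e, X ! e) < nverts G" "dart_head G (e, X ! e) < nverts G"
    if "e < length (edges G)" for e
    using wf_mgraph_edge[OF wf that] by auto
  show ?thesis
  proof (cases b)
    case True
    define g where "g = f(v := Suc (\<Sum>u<nverts G. f u))"
    have le: "f u \<le> (\<Sum>u<nverts G. f u)" if "u < nverts G" for u
      using that by (intro member_le_sum) auto
    have "g (dart_tail G (e, ?X ! e)) < g (dart_head G (e, ?X ! e))" if e: "e < length (edges G)" for e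
    proof -
      have h: "dart_head G (e, X ! e) \<noteq> v" using v True e by (simp add: flippable_def is_source_iff)
      show ?thesis
      proof (cases "dart_tail G (e, X ! e) = v")
        case True
        then show ?thesis using at[OF e] h le[OF lt(2)[OF e]]
          by (simp add: g_def less_Suc_eq_le del: dart_head.simps dart_tail.simps)
      next
        case False
        then show ?thesis using away[OF e] h f[OF e] by (simp add: g_def del: dart_head.simps dart_tail.simps)
      qed
    qed
    then show ?thesis unfolding ranked_def by blast
  next
    case False
    define g where "g = (\<lambda>u. if u = v then 0 else Suc (f u))"
    have "g (dart_tail G (e, ?X ! e)) < g (dart_head G (e, ?X ! e))" if e: "e < length (edges G)" for e
    proof -
      have h: "dart_tail G (e, X ! e) \<noteq> v" using v False e by (simp add: flippable_def is_sink_iff)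
      show ?thesis
      proof (cases "dart_head G (e, X ! e) = v")
        case True
        then show ?thesis using at[OF e] h by (simp add: g_def del: dart_head.simps dart_tail.simps)
      next
        case False
        then show ?thesis using away[OF e] h f[OF e] by (simp add: g_def del: dart_head.simps dart_tail.simps)
      qed
    qed
    then show ?thesis unfolding ranked_def by blast
  qed
qed

text \<open>Where the potential is maximal and positive, all edges leaving this level set point outwards,
  so a vertex of least rank in it is a source; dually for the minimum.\<close>

lemma exists_flippable:
  assumes wf: "wf_mgraph G" and rk: "ranked G X" and pot: "potential G X Y z"
    and v: "v < nverts G" "z v \<noteq> 0"
  obtains b u where "u < nverts G" "if b then z u > 0 else z u < 0" "flippable G X b u"
proof -
  from rk obtain f :: "nat \<Rightarrow> nat" where
    f: "\<And>e. e < length (edges G) \<Longrightarrow> f (dart_tail G (e, X ! e)) < f (dart_head G (e, X ! e))"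
    by (auto simp: ranked_def)
  have lt: "dart_tail G (e, X ! e) < nverts G" "dart_head G (e, X ! e) < nverts G"
    if "e < length (edges G)" for e
    using wf_mgraph_edge[OF wf that] by auto
  \<comment> \<open>An arc of \<open>X\<close> is either kept in \<open>Y\<close>, with gain 0, or
    reversed, with gain -1, so the potential never rises along it.\<close>
  have mono: "z (dart_head G (e, X ! e)) \<le> z (dart_tail G (e, X ! e))" if "e < length (edges G)" for e
    using potential_dart[OF pot, of "(e, X ! e)"] that
    by (simp add: dart_gain_def of_bool_def split: if_splits del: dart_head.simps dart_tail.simps)
  define V where "V = {..<nverts G}"
  have V: "finite V" "V \<noteq> {}" using v by (auto simp: V_def)
  show thesis
  proof (cases "z v > 0")
    case True
    define S where "S = {u \<in> V. z u = Max (z ` V)}"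
    have S: "finite S" "S \<noteq> {}" using V Max_in[of "z ` V"] unfolding S_def by (simp, fastforce)
    then have "Min (f ` S) \<in> f ` S" by (intro Min_in) auto
    then obtain u where u: "u \<in> S" "f u = Min (f ` S)" by force
    have min: "f u \<le> f w" if "w \<in> S" for w using S that by (simp add: u(2))
    have max: "z w \<le> z u" if "w \<in> V" for w using u(1) V that by (simp add: S_def)
    have "dart_head G (e, X ! e) \<noteq> u" if e: "e < length (edges G)" for e
    proof
      let ?w = "dart_tail G (e, X ! e)"
      assume h: "dart_head G (e, X ! e) = u"
      have w: "?w \<in> V" using lt(1)[OF e] by (simp add: V_def del: dart_tail.simps)
      have "z ?w = z u" using mono[OF e] max[OF w] unfolding h by linarith
      then have "?w \<in> S" using u(1) w by (simp add: S_def del: dart_tail.simps)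
      from min[OF this] f[OF e] show False unfolding h by simp
    qed
    moreover have "z u > 0" using max[of v] True v by (simp add: V_def)
    moreover have "u < nverts G" using u(1) by (simp add: S_def V_def)
    ultimately show thesis using that[of u True] by (simp add: flippable_def is_source_iff)
  next
    case False
    define S where "S = {u \<in> V. z u = Min (z ` V)}"
    have S: "finite S" "S \<noteq> {}" using V Min_in[of "z ` V"] unfolding S_def by (simp, fastforce)
    then have "Max (f ` S) \<in> f ` S" by (intro Max_in) auto
    then obtain u where u: "u \<in> S" "f u = Max (f ` S)" by force
    have max: "f w \<le> f u" if "w \<in> S" for w using S that by (simp add: u(2))
    have min: "z u \<le> z w" if "w \<in> V" for w using u(1) V that by (simp add: S_def)
    have "dart_tail G (e, X ! e) \<noteq> u" if e: "e < length (edges G)" for e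
    proof
      let ?w = "dart_head G (e, X ! e)"
      assume h: "dart_tail G (e, X ! e) = u"
      have w: "?w \<in> V" using lt(2)[OF e] by (simp add: V_def del: dart_head.simps)
      have "z ?w = z u" using mono[OF e] min[OF w] unfolding h by linarith
      then have "?w \<in> S" using u(1) w by (simp add: S_def del: dart_head.simps)
      from max[OF this] f[OF e] show False unfolding h by simp
    qed
    moreover have "z u < 0" using min[of v] False v by (simp add: V_def)
    moreover have "u < nverts G" using u(1) by (simp add: S_def V_def)
    ultimately show thesis using that[of u False] by (simp add: flippable_def is_sink_iff)
  qed
qed

section \<open>The greedy procedure and its progress\<close>

type_synonym greedy_state = "orientation \<times> (nat \<Rightarrow> int) \<times> nat list"

fun wants_flip :: "mgraph \<Rightarrow> bool \<Rightarrow> nat \<Rightarrow> greedy_state \<Rightarrow> bool" where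
  "wants_flip G b v (X, z, ws) \<longleftrightarrow> (if b then z v > 0 else z v < 0) \<and> flippable G X b v"

fun try_flip :: "mgraph \<Rightarrow> bool \<Rightarrow> nat \<Rightarrow> greedy_state \<Rightarrow> greedy_state" where
  "try_flip G b v (X, z, ws) =
     (if wants_flip G b v (X, z, ws)
      then (reverse_at G v X, z(v := if b then z v - 1 else z v + 1), ws @ [v]) else (X, z, ws))"

fun remaining :: "mgraph \<Rightarrow> greedy_state \<Rightarrow> nat" where
  "remaining G (X, z, ws) = (\<Sum>v<nverts G. nat \<bar>z v\<bar>)"

text \<open>A state holds the current orientation, the potential from it to \<open>Y\<close>, and
  the flips made since \<open>X0\<close>. The last conjunct, with fixed \<open>N\<close>, says that
  no flip is wasted.\<close>

fun greedy_inv :: "mgraph \<Rightarrow> nat \<Rightarrow> orientation \<Rightarrow> orientation \<Rightarrow> nat \<Rightarrow> greedy_state \<Rightarrow> bool" where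
  "greedy_inv G r X0 Y N (X, z, ws) \<longleftrightarrow>
     length X = length (edges G) \<and> ranked G X \<and> potential G X Y z \<and> z r = 0 \<and>
     (\<forall>v < nverts G. \<bar>z v\<bar> < int (nverts G)) \<and>
     flip_sequence G r X0 ws X \<and> length ws + remaining G (X, z, ws) = N"

lemma flip_sequence_append:
  "flip_sequence G r X (vs @ ws) Y \<longleftrightarrow> (\<exists>Z. flip_sequence G r X vs Z \<and> flip_sequence G r Z ws Y)"
  by (induction vs arbitrary: X) auto

lemma remaining_flip:
  assumes "wants_flip G b v s" "v < nverts G"
  shows "Suc (remaining G (try_flip G b v s)) = remaining G s"
proof (cases s)
  case (fields X z ws)
  have *: "(\<Sum>u<nverts G. g u) = g v + (\<Sum>u\<in>{..<nverts G} - {v}. g u)" for g :: "nat \<Rightarrow> nat"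
    using assms(2) by (intro sum.remove) auto
  have "Suc (nat \<bar>if b then z v - 1 else z v + 1\<bar>) = nat \<bar>z v\<bar>"
    using assms(1) by (auto simp: fields split: if_splits)
  then show ?thesis using assms(1)
    by (simp add: fields * del: wants_flip.simps)
qed

lemma greedy_inv_try_flip:
  assumes wf: "wf_mgraph G" and inv: "greedy_inv G r X0 Y N s" and v: "v < nverts G"
  shows "greedy_inv G r X0 Y N (try_flip G b v s)"
proof (cases "wants_flip G b v s")
  case True
  obtain X z ws where s: "s = (X, z, ws)" by (cases s)
  note I = inv[unfolded s greedy_inv.simps]
  have fl: "flippable G X b v" and zv: "if b then z v > 0 else z v < 0" using True by (simp_all add: s)
  define z' where "z' = z(v := if b then z v - 1 else z v + 1)"
  have s': "try_flip G b v s = (reverse_at G v X, z', ws @ [v])"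
    using True by (simp add: s z'_def del: wants_flip.simps)
  have "z' = (\<lambda>u. z u - (if u = v then if b then 1 else - 1 else 0))" by (auto simp: z'_def)
  then have "potential G (reverse_at G v X) Y z'"
    using potential_diff[of G X Y z, OF _ potential_flip[OF fl]] I by simp
  moreover have "v \<noteq> r" using zv I by (auto split: if_splits)
  then have "flip_sequence G r X0 (ws @ [v]) (reverse_at G v X)"
    using I fl by (auto simp: flip_sequence_append flippable_def split: if_splits)
  moreover have "\<bar>z' u\<bar> < int (nverts G)" if "u < nverts G" for u
  proof -
    have "\<bar>z u\<bar> < int (nverts G)" using I that by blast
    then show ?thesis using zv by (auto simp: z'_def split: if_splits)
  qed
  moreover have "z' r = 0" using I \<open>v \<noteq> r\<close> by (simp add: z'_def)
  moreover have "ranked G (reverse_at G v X)" using ranked_reverse_at[OF wf _ _ fl] I by blast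
  moreover have "length (ws @ [v]) + remaining G (reverse_at G v X, z', ws @ [v]) = N"
    using remaining_flip[OF True v] I unfolding s' by (simp add: s)
  ultimately show ?thesis unfolding s' greedy_inv.simps using I by simp
next
  case False
  then have "try_flip G b v s = s" by (cases s) (simp del: wants_flip.simps)
  with inv show ?thesis by simp
qed

abbreviation greedy_run :: "mgraph \<Rightarrow> (bool \<times> nat) list \<Rightarrow> greedy_state \<Rightarrow> greedy_state" where
  "greedy_run G \<equiv> fold (\<lambda>(b, v). try_flip G b v)"

lemma greedy_inv_run:
  assumes "wf_mgraph G" "greedy_inv G r X0 Y N s" "snd ` set L \<subseteq> {..<nverts G}"
  shows "greedy_inv G r X0 Y N (greedy_run G L s)"
  using assms
proof (induction L arbitrary: s)
  case (Cons a L)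
  obtain b v where a: "a = (b, v)" by fastforce
  have "greedy_inv G r X0 Y N (try_flip G b v s)"
    using Cons.prems by (intro greedy_inv_try_flip) (simp_all add: a)
  with Cons show ?case by (simp add: a)
qed simp

lemma remaining_try_flip:
  assumes "v < nverts G"
  shows "remaining G (try_flip G b v s) \<le> remaining G s"
proof (cases "wants_flip G b v s")
  case True
  then show ?thesis using remaining_flip[OF True assms] by simp
next
  case False
  then have "try_flip G b v s = s" by (cases s) (simp del: wants_flip.simps)
  then show ?thesis by simp
qed

lemma remaining_run_le:
  assumes "snd ` set L \<subseteq> {..<nverts G}"
  shows "remaining G (greedy_run G L s) \<le> remaining G s"
  using assms
proof (induction L arbitrary: s)
  case (Cons a L)
  obtain b v where a: "a = (b, v)" by fastforce
  have "remaining G (greedy_run G L (try_flip G b v s)) \<le> remaining G (try_flip G b v s)"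
    using Cons by simp
  also have "\<dots> \<le> remaining G s" using Cons.prems by (intro remaining_try_flip) (simp add: a)
  finally show ?case by (simp add: a)
qed simp

text \<open>Either an attempt before \<open>(b, v)\<close> succeeds and already lowers
  \<open>remaining\<close>, or the state is still \<open>s\<close> when \<open>(b, v)\<close> has
  its turn.\<close>

lemma remaining_run_less:
  assumes "snd ` set L \<subseteq> {..<nverts G}" "(b, v) \<in> set L" "wants_flip G b v s"
  shows "remaining G (greedy_run G L s) < remaining G s"
  using assms
proof (induction L arbitrary: s)
  case (Cons a L)
  obtain b' v' where a: "a = (b', v')" by fastforce
  have v': "v' < nverts G" and L: "snd ` set L \<subseteq> {..<nverts G}" using Cons.prems by (auto simp: a)
  show ?case
  proof (cases "wants_flip G b' v' s")
    case True
    have "remaining G (greedy_run G L (try_flip G b' v' s)) \<le> remaining G (try_flip G b' v' s)"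
      by (rule remaining_run_le[OF L])
    also have "\<dots> < remaining G s" using remaining_flip[OF True v'] by simp
    finally show ?thesis by (simp add: a)
  next
    case False
    then have "try_flip G b' v' s = s" by (cases s) (simp del: wants_flip.simps)
    moreover have "(b, v) \<in> set L" using Cons.prems(2,3) False by (auto simp: a)
    ultimately show ?thesis using Cons.IH[OF L _ Cons.prems(3)] by (simp add: a)
  qed
qed simp

definition greedy_pass :: "mgraph \<Rightarrow> greedy_state \<Rightarrow> greedy_state" where
  "greedy_pass G = fold (\<lambda>v s. try_flip G False v (try_flip G True v s)) [0..<nverts G]"

lemma greedy_pass_eq_run:
  "greedy_pass G = greedy_run G (concat (map (\<lambda>v. [(True, v), (False, v)]) [0..<nverts G]))"
proof -
  have "fold (\<lambda>v s. try_flip G False v (try_flip G True v s)) vs s =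
    greedy_run G (concat (map (\<lambda>v. [(True, v), (False, v)]) vs)) s" for vs s
    by (induction vs arbitrary: s) auto
  then show ?thesis by (auto simp: greedy_pass_def)
qed

text \<open>As long as the potential is not zero, \<open>exists_flippable\<close> provides a
  possible flip at the beginning of a pass, so each pass makes at least one flip.\<close>

lemma greedy_passes:
  assumes wf: "wf_mgraph G" and inv: "greedy_inv G r X0 Y N s"
  shows "greedy_inv G r X0 Y N ((greedy_pass G ^^ k) s)"
    and "remaining G ((greedy_pass G ^^ k) s) \<le> remaining G s - k"
proof -
  let ?L = "concat (map (\<lambda>v. [(True, v), (False, v)]) [0..<nverts G])"
  have L: "snd ` set ?L \<subseteq> {..<nverts G}" by auto
  have step: "remaining G (greedy_pass G t) \<le> remaining G t - 1" if t: "greedy_inv G r X0 Y N t" for t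
  proof (cases "remaining G t = 0")
    case True
    then show ?thesis using remaining_run_le[OF L, of t] by (simp add: greedy_pass_eq_run)
  next
    case False
    obtain X z ws where tt: "t = (X, z, ws)" by (cases t)
    from False obtain v where "v < nverts G" "z v \<noteq> 0" by (auto simp: tt)
    moreover have "ranked G X" "potential G X Y z" using t by (simp_all add: tt)
    ultimately obtain b u where "u < nverts G" "if b then z u > 0 else z u < 0" "flippable G X b u"
      using exists_flippable[OF wf] by metis
    then have "(b, u) \<in> set ?L" "wants_flip G b u t" by (cases b; force simp: tt)+
    from remaining_run_less[OF L this] show ?thesis by (simp add: greedy_pass_eq_run)
  qed
  show *: "greedy_inv G r X0 Y N ((greedy_pass G ^^ k) s)" for k
    by (induction k) (auto simp: greedy_pass_eq_run intro: greedy_inv_run[OF wf _ L] inv)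
  show "remaining G ((greedy_pass G ^^ k) s) \<le> remaining G s - k"
  proof (induction k)
    case (Suc k)
    then show ?case using step[OF *[of k]] by simp
  qed simp
qed

lemma greedy_shortest:
  assumes wf: "wf_mgraph G" and con: "connected_mgraph G" and r: "r < nverts G"
    and X: "length X = length (edges G)" and Y: "length Y = length (edges G)" and rk: "ranked G X"
    and z: "potential G X Y z" "z r = 0" "\<And>v. v < nverts G \<Longrightarrow> \<bar>z v\<bar> < int (nverts G)"
    and fin: "(greedy_pass G ^^ (nverts G * nverts G)) (X, z, []) = (X', z', ws)"
  shows "shortest_flip_sequence G r X ws Y"
proof -
  let ?s = "(X, z, []) :: greedy_state" and ?n = "nverts G"
  have inv: "greedy_inv G r X Y (remaining G ?s) ?s" using X rk z by simp
  have "remaining G ?s \<le> ?n * ?n"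
  proof -
    have "remaining G ?s \<le> (\<Sum>v<?n. ?n)"
      unfolding remaining.simps by (rule sum_mono) (use z(3) in force)
    then show ?thesis by simp
  qed
  then have 0: "remaining G (X', z', ws) = 0"
    using greedy_passes(2)[OF wf inv, of "?n * ?n"] by (simp add: fin)
  have inv': "greedy_inv G r X Y (remaining G ?s) (X', z', ws)"
    using greedy_passes(1)[OF wf inv, of "?n * ?n"] by (simp only: fin)
  have "X' = Y"
  proof (rule nth_equalityI)
    show "length X' = length Y" using inv' Y by simp
    fix e assume "e < length X'"
    then have e: "e < length (edges G)" using inv' by simp
    have "z' (fst (edges G ! e)) = 0" "z' (snd (edges G ! e)) = 0"
      using 0 wf_mgraph_edge[OF wf e] by simp_all
    moreover have "potential G X' Y z'" using inv' by simp
    ultimately show "X' ! e = Y ! e" using e by (auto simp: potential_def of_bool_def split: if_splits)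
  qed
  then have fs: "flip_sequence G r X ws Y" using inv' by simp
  have "length ws \<le> length us" if us: "flip_sequence G r X us Y" for us
  proof -
    from flip_sequence_potential[OF us X] obtain f
      where f: "potential G X Y f" "f r = 0" "(\<Sum>v<?n. \<bar>f v\<bar>) \<le> int (length us)" by blast
    have "f v = z v" if "v < ?n" for v
      by (rule potential_unique[OF con wf f(1) z(1) _ r that]) (simp add: f z)
    then have "(\<Sum>v<?n. \<bar>f v\<bar>) = (\<Sum>v<?n. \<bar>z v\<bar>)" by simp
    also have "\<dots> = int (remaining G ?s)" by simp
    also have "remaining G ?s = length ws" using inv' 0 by simp
    finally show ?thesis using f(3) by simp
  qed
  with fs show ?thesis by (simp add: shortest_flip_sequence_def)
qed

section \<open>Verification of RAM programs\<close>

text \<open>Total correctness with a clock: \<open>c\<close> is the number of steps made before, and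
  the postcondition sees the final count. Sequencing thus becomes nesting, and determinism turns the
  basic cases into equivalences for the simplifier.\<close>

definition wp :: "ram_prog \<Rightarrow> (nat \<Rightarrow> ram_state \<Rightarrow> bool) \<Rightarrow> nat \<Rightarrow> ram_state \<Rightarrow> bool" where
  "wp P Q c s \<longleftrightarrow> (\<exists>t s'. ram_exec P s t s' \<and> Q (c + t) s')"

lemma wp_eqI: "ram_exec P s t s' \<Longrightarrow> wp P Q c s \<longleftrightarrow> Q (c + t) s'"
  unfolding wp_def using ram_exec_deterministic by blast

lemma wp_simps [simp]:
  "wp Skip Q c s \<longleftrightarrow> Q (c + 1) s"
  "wp (Const i k) Q c s \<longleftrightarrow> Q (c + 1) (set_mem i k s)"
  "wp (Add i j l) Q c s \<longleftrightarrow> Q (c + 1) (set_mem i (mem s j + mem s l) s)"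
  "wp (Sub i j l) Q c s \<longleftrightarrow> Q (c + 1) (set_mem i (mem s j - mem s l) s)"
  "wp (Load i j) Q c s \<longleftrightarrow> Q (c + 1) (set_mem i (mem s (mem s j)) s)"
  "wp (Store i j) Q c s \<longleftrightarrow> Q (c + 1) (set_mem (mem s i) (mem s j) s)"
  "wp (Read i) Q c s \<longleftrightarrow>
     Q (c + 1) (set_mem i (case inp s of [] \<Rightarrow> 0 | x # _ \<Rightarrow> x) (s\<lparr>inp := tl (inp s)\<rparr>))"
  "wp (Print i) Q c s \<longleftrightarrow> Q (c + 1) (s\<lparr>outp := outp s @ [mem s i]\<rparr>)"
  by (rule wp_eqI, rule ram_exec.intros)+

lemma wp_Seq [simp]: "wp (Seq P R) Q c s \<longleftrightarrow> wp P (wp R Q) c s"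
proof
  assume "wp (Seq P R) Q c s"
  then obtain t s' where "ram_exec (Seq P R) s t s'" "Q (c + t) s'" by (auto simp: wp_def)
  then show "wp P (wp R Q) c s"
    by (elim ram_exec_elims) (fastforce simp: wp_def add.assoc)
next
  assume "wp P (wp R Q) c s"
  then obtain t s' t' s'' where "ram_exec P s t s'" "ram_exec R s' t' s''" "Q (c + t + t') s''"
    by (auto simp: wp_def)
  then show "wp (Seq P R) Q c s"
    unfolding wp_def by (intro exI[of _ "t + t'"] exI[of _ s'']) (simp add: add.assoc ram_exec.Seq)
qed

lemma wp_IfNZ [simp]:
  "wp (IfNZ i P R) Q c s \<longleftrightarrow> (if mem s i \<noteq> 0 then wp P Q (c + 1) s else wp R Q (c + 1) s)"
proof
  assume "wp (IfNZ i P R) Q c s"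
  then obtain t s' where "ram_exec (IfNZ i P R) s t s'" "Q (c + t) s'" by (auto simp: wp_def)
  then show "if mem s i \<noteq> 0 then wp P Q (c + 1) s else wp R Q (c + 1) s"
    by (elim ram_exec_elims) (fastforce simp: wp_def add.assoc)+
next
  assume *: "if mem s i \<noteq> 0 then wp P Q (c + 1) s else wp R Q (c + 1) s"
  then obtain t s' where "ram_exec (if mem s i \<noteq> 0 then P else R) s t s'" "Q (c + 1 + t) s'"
    by (auto simp: wp_def split: if_splits)
  then show "wp (IfNZ i P R) Q c s"
    unfolding wp_def
    using ram_exec.IfTrue[of s i P t s' R] ram_exec.IfFalse[of s i R t s' P]
    by (intro exI[of _ "1 + t"] exI[of _ s']) (auto split: if_splits)
qed

lemma set_mem_simps [simp]:
  "mem (set_mem i x s) j = (if j = i then x else mem s j)"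
  "inp (set_mem i x s) = inp s" "outp (set_mem i x s) = outp s"
  by (simp_all add: set_mem_def)

text \<open>The addresses below 24 serve as registers; above them, eight arrays are interleaved.\<close>

definition cell :: "nat \<Rightarrow> nat \<Rightarrow> nat" where
  "cell a j = 24 + a + 8 * j"

lemma cell_neq [simp]: "i < 24 \<Longrightarrow> cell a j \<noteq> i" "i < 24 \<Longrightarrow> i \<noteq> cell a j"
  by (auto simp: cell_def)

lemma cell_eq_iff: "a < 8 \<Longrightarrow> b < 8 \<Longrightarrow> cell a j = cell b l \<longleftrightarrow> a = b \<and> j = l"
proof -
  have "a = b \<and> j = l" if "a < 8" "b < 8" "a + 8 * j = b + 8 * l"
  proof -
    have "(a + 8 * j) mod 8 = (b + 8 * l) mod 8" by (simp only: that(3))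
    then have "a = b" using that(1,2) by (simp only: mod_mult_self2 mod_less)
    then show ?thesis using that(3) by simp
  qed
  then show "a < 8 \<Longrightarrow> b < 8 \<Longrightarrow> ?thesis" by (auto simp: cell_def)
qed

text \<open>Cells of an array number 8 would coincide with those of array 0, one index further. With
  the default 0 a store changes exactly one entry of this function.\<close>

definition arrays :: "ram_state \<Rightarrow> nat \<Rightarrow> nat \<Rightarrow> nat" where
  "arrays s a j = (if a < 8 then mem s (cell a j) else 0)"

lemma mem_cell [simp]: "a < 8 \<Longrightarrow> mem s (cell a j) = arrays s a j"
  by (simp add: arrays_def)

lemma arrays_set_mem [simp]:
  "i < 24 \<Longrightarrow> arrays (set_mem i x s) = arrays s"
  "a < 8 \<Longrightarrow> arrays (set_mem (cell a j) x s) = (arrays s)(a := (arrays s a)(j := x))"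
  by (auto simp: arrays_def fun_eq_iff cell_eq_iff simp del: mem_cell)

lemma arrays_inp_outp [simp]:
  "arrays (s\<lparr>inp := xs\<rparr>) = arrays s" "arrays (s\<lparr>outp := ys\<rparr>) = arrays s"
  by (auto simp: arrays_def fun_eq_iff simp del: mem_cell)

text \<open>Three doublings give 8 times the index; registers 22 and 23 are reserved for this
  address computation.\<close>

definition get :: "nat \<Rightarrow> nat \<Rightarrow> nat \<Rightarrow> ram_prog" where
  "get r a j = Seq (Add 23 j j) (Seq (Add 23 23 23) (Seq (Add 23 23 23)
     (Seq (Const 22 (24 + a)) (Seq (Add 23 23 22) (Load r 23)))))"

definition put :: "nat \<Rightarrow> nat \<Rightarrow> nat \<Rightarrow> ram_prog" where
  "put a j r = Seq (Add 23 j j) (Seq (Add 23 23 23) (Seq (Add 23 23 23)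
     (Seq (Const 22 (24 + a)) (Seq (Add 23 23 22) (Store 23 r)))))"

text \<open>The side effect of an array access on the address registers, kept folded so that the
  simplifier discards it when other registers or arrays are read.\<close>

definition clobber :: "nat \<Rightarrow> nat \<Rightarrow> ram_state \<Rightarrow> ram_state" where
  "clobber a x s = set_mem 23 (cell a x) (set_mem 22 (24 + a) s)"

lemma clobber_simps [simp]:
  "i < 22 \<Longrightarrow> mem (clobber a x s) i = mem s i"
  "arrays (clobber a x s) = arrays s" "inp (clobber a x s) = inp s" "outp (clobber a x s) = outp s"
  by (simp_all add: clobber_def)

lemma set_mem_set_mem [simp]: "set_mem i x (set_mem i y s) = set_mem i x s"
  by (simp add: set_mem_def)

lemma set_mem_commute: "i \<noteq> j \<Longrightarrow> set_mem i x (set_mem j y s) = set_mem j y (set_mem i x s)"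
  by (simp add: set_mem_def fun_upd_twist)

lemma cell_address: "x + x + (x + x) + (x + x + (x + x)) + (24 + a) = cell a x"
  by (simp add: cell_def)

lemma wp_get [simp]:
  assumes "a < 8" "j < 22"
  shows "wp (get r a j) Q c s \<longleftrightarrow> Q (c + 6) (set_mem r (arrays s a (mem s j)) (clobber a (mem s j) s))"
proof -
  have c: "Suc (Suc (Suc (Suc (Suc (Suc c))))) = c + 6" by simp
  show ?thesis
    using assms by (simp add: c get_def clobber_def cell_address set_mem_commute[of 22 23])
qed

lemma wp_put [simp]:
  assumes "a < 8" "j < 22" "r < 22"
  shows "wp (put a j r) Q c s \<longleftrightarrow> Q (c + 6) (set_mem (cell a (mem s j)) (mem s r) (clobber a (mem s j) s))"
proof -
  have c: "Suc (Suc (Suc (Suc (Suc (Suc c))))) = c + 6" by simp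
  show ?thesis
    using assms by (simp add: c put_def clobber_def cell_address set_mem_commute[of 22 23])
qed

section \<open>Specifications with time bounds\<close>

type_synonym abs_state = "(nat \<Rightarrow> nat \<Rightarrow> nat) \<times> nat list \<times> nat list"

text \<open>Registers are forgotten: a program piece is specified as a function on this triple, with
  the relevant registers as parameters.\<close>

definition abs_of :: "ram_state \<Rightarrow> abs_state" where
  "abs_of s = (arrays s, inp s, outp s)"

lemma abs_of_set_mem [simp]: "i < 24 \<Longrightarrow> abs_of (set_mem i x s) = abs_of s"
  by (simp add: abs_of_def)

text \<open>The registers from \<open>L\<close> upwards are scratch, so that the nesting level of a loop decides which
  registers its body may use.\<close>

definition does :: "nat \<Rightarrow> ram_prog \<Rightarrow> nat \<Rightarrow> ram_state \<Rightarrow> abs_state \<Rightarrow> bool" where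
  "does L P T s B \<longleftrightarrow> wp P (\<lambda>t s'. t \<le> T \<and> (\<forall>i<L. mem s' i = mem s i) \<and> abs_of s' = B) 0 s"

lemma does_iff:
  "does L P T s B \<longleftrightarrow> (\<exists>t s'. ram_exec P s t s' \<and> t \<le> T \<and> (\<forall>i<L. mem s' i = mem s i) \<and> abs_of s' = B)"
  by (simp add: does_def wp_def)

lemma does_mono:
  assumes "does L P T s B" "T \<le> T'" "L' \<le> L"
  shows "does L' P T' s B"
proof -
  obtain t s' where "ram_exec P s t s'" "t \<le> T" "\<forall>i<L. mem s' i = mem s i" "abs_of s' = B"
    using assms(1) by (auto simp: does_iff)
  with assms(2,3) show ?thesis unfolding does_iff by (intro exI[of _ t] exI[of _ s']) auto
qed

lemma does_Seq:
  assumes "does L P T s A" "\<And>s'. \<forall>i<L. mem s' i = mem s i \<Longrightarrow> abs_of s' = A \<Longrightarrow> does L R T' s' B"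
  shows "does L (Seq P R) (T + T') s B"
proof -
  obtain t s' where 1: "ram_exec P s t s'" "t \<le> T" "\<forall>i<L. mem s' i = mem s i" "abs_of s' = A"
    using assms(1) by (auto simp: does_iff)
  obtain t' s'' where 2: "ram_exec R s' t' s''" "t' \<le> T'" "\<forall>i<L. mem s'' i = mem s' i" "abs_of s'' = B"
    using assms(2)[OF 1(3,4)] by (auto simp: does_iff)
  show ?thesis unfolding does_iff
    using 1 2 by (intro exI[of _ "t + t'"] exI[of _ s'']) (auto intro: ram_exec.Seq)
qed

lemma does_IfNZ:
  assumes "mem s i \<noteq> 0 \<Longrightarrow> does L P T s B" "mem s i = 0 \<Longrightarrow> does L R T s B"
  shows "does L (IfNZ i P R) (T + 1) s B"
proof (cases "mem s i = 0")
  case True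
  then obtain t s' where "ram_exec R s t s'" "t \<le> T" "\<forall>i<L. mem s' i = mem s i" "abs_of s' = B"
    using assms(2) by (auto simp: does_iff)
  with True show ?thesis unfolding does_iff
    using ram_exec.IfFalse[of s i R t s' P] by (intro exI[of _ "1 + t"] exI[of _ s']) auto
next
  case False
  then obtain t s' where "ram_exec P s t s'" "t \<le> T" "\<forall>i<L. mem s' i = mem s i" "abs_of s' = B"
    using assms(1) by (auto simp: does_iff)
  with False show ?thesis unfolding does_iff
    using ram_exec.IfTrue[of s i P t s' R] by (intro exI[of _ "1 + t"] exI[of _ s']) auto
qed

text \<open>Register 1 is assumed to hold the constant 1.\<close>

definition for_loop :: "nat \<Rightarrow> nat \<Rightarrow> ram_prog \<Rightarrow> ram_prog" where
  "for_loop i k P = Seq (Const i 0) (Seq (Sub 21 k i)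
     (WhileNZ 21 (Seq P (Seq (Add i i 1) (Sub 21 k i)))))"

text \<open>Each round adds 3 steps for test, increment and subtraction; two initial steps and the
  last test make the other 3. Register 21 is recomputed from \<open>k\<close> and \<open>i\<close>
  after the body, so nested loops can share it.\<close>

lemma does_for_loop:
  assumes one: "mem s 1 = 1" and i: "1 < i" "k < i" "i < 21"
    and body: "\<And>j r. j < mem s k \<Longrightarrow> \<forall>l<i. mem r l = mem s l \<Longrightarrow> mem r i = j \<Longrightarrow>
      does (Suc i) P T r (f j (abs_of r))"
  shows "does i (for_loop i k P) (mem s k * (T + 3) + 3) s (fold f [0..<mem s k] (abs_of s))"
proof -
  define K where "K = mem s k"
  define B where "B = Seq P (Seq (Add i i 1) (Sub 21 k i))"
  have loop: "\<exists>t s'. ram_exec (WhileNZ 21 B) r t s' \<and> t \<le> (K - j) * (T + 3) + 1 \<and>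
      (\<forall>l<i. mem s' l = mem s l) \<and> abs_of s' = fold f [j..<K] (abs_of r)"
    if "j \<le> K" "mem r i = j" "mem r 21 = K - j" "\<forall>l<i. mem r l = mem s l" for j r
    using that
  proof (induction "K - j" arbitrary: j r)
    case 0
    then show ?case using ram_exec.WhileFalse[of r 21 B]
      by (intro exI[of _ 1] exI[of _ r]) auto
  next
    case (Suc d)
    then have j: "j < K" by simp
    obtain t r1 where 1: "ram_exec P r t r1" "t \<le> T" "\<forall>l<Suc i. mem r1 l = mem r l"
        "abs_of r1 = f j (abs_of r)"
      using body[of j r] Suc.prems j by (auto simp: does_iff K_def)
    define r2 where "r2 = set_mem i (Suc j) r1"
    define r3 where "r3 = set_mem 21 (K - Suc j) r2"
    have r1: "mem r1 i = j" "mem r1 1 = 1" "mem r1 k = K"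
      using 1(3) Suc.prems one i by (auto simp: K_def)
    have "ram_exec (Add i i 1) r1 1 r2"
      using ram_exec.Add[of i i 1 r1] r1 by (simp add: r2_def)
    moreover have "ram_exec (Sub 21 k i) r2 1 r3"
      using ram_exec.Sub[of 21 k i r2] r1 i by (simp add: r2_def r3_def)
    ultimately have B: "ram_exec B r (t + (1 + 1)) r3"
      unfolding B_def by (intro ram_exec.Seq[OF 1(1)] ram_exec.Seq)
    have "d = K - Suc j" "Suc j \<le> K" "mem r3 i = Suc j" "mem r3 21 = K - Suc j"
      "\<forall>l<i. mem r3 l = mem s l"
      using Suc.hyps(2) j i 1(3) Suc.prems(4) by (auto simp: r3_def r2_def)
    from Suc.hyps(1)[OF this] obtain t' s' where 2: "ram_exec (WhileNZ 21 B) r3 t' s'"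
      "t' \<le> (K - Suc j) * (T + 3) + 1" "\<forall>l<i. mem s' l = mem s l"
      "abs_of s' = fold f [Suc j..<K] (abs_of r3)" by blast
    have "abs_of r3 = f j (abs_of r)" using i 1(4) by (simp add: r3_def r2_def)
    then have "abs_of s' = fold f [j..<K] (abs_of r)" using 2(4) j by (simp add: upt_conv_Cons)
    moreover have "ram_exec (WhileNZ 21 B) r (1 + (t + (1 + 1)) + t') s'"
      by (rule ram_exec.WhileTrue[OF _ B 2(1)]) (use Suc.prems j in simp)
    moreover have "K - j = Suc (K - Suc j)" using j by simp
    then have "1 + (t + (1 + 1)) + t' \<le> (K - j) * (T + 3) + 1" using 1(2) 2(2) by simp
    ultimately show ?case using 2(3) by blast
  qed
  define r where "r = set_mem 21 (K - 0) (set_mem i 0 s)"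
  have "ram_exec (Const i 0) s 1 (set_mem i 0 s)" by (rule ram_exec.Const)
  moreover have "ram_exec (Sub 21 k i) (set_mem i 0 s) 1 r"
    using ram_exec.Sub[of 21 k i "set_mem i 0 s"] i by (simp add: r_def K_def)
  moreover obtain t s' where 2: "ram_exec (WhileNZ 21 B) r t s'" "t \<le> (K - 0) * (T + 3) + 1"
      "\<forall>l<i. mem s' l = mem s l" "abs_of s' = fold f [0..<K] (abs_of r)"
    using loop[of 0 r] i by (auto simp: r_def)
  ultimately have "ram_exec (for_loop i k P) s (1 + (1 + t)) s'"
    unfolding for_loop_def B_def by (blast intro: ram_exec.Seq)
  moreover have "abs_of r = abs_of s" using i by (simp add: r_def)
  ultimately show ?thesis
    using 2 unfolding does_iff K_def[symmetric] by (intro exI[of _ "1 + (1 + t)"] exI[of _ s']) auto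
qed

section \<open>The program\<close>

definition read_prog :: "nat \<Rightarrow> ram_prog" where
  "read_prog a = Seq (Read 9) (put a 8 9)"

fun read_abs :: "nat \<Rightarrow> nat \<Rightarrow> abs_state \<Rightarrow> abs_state" where
  "read_abs a e (A, i, out) = (A(a := (A a)(e := case i of [] \<Rightarrow> 0 | x # _ \<Rightarrow> x)), tl i, out)"

lemma does_read:
  assumes "a < 8"
  shows "does 9 (read_prog a) 7 s (read_abs a (mem s 8) (abs_of s))"
  using assms by (simp add: does_def read_prog_def abs_of_def)

text \<open>Carries the potential across an edge with exactly one known end; a 0 in array 4 means
  unknown. Adding before subtracting keeps the truncated subtraction exact.\<close>

definition relax_prog :: ram_prog where
  "relax_prog = Seq (get 9 0 8) (Seq (get 10 1 8) (Seq (get 11 4 9) (Seq (get 12 4 10)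
     (Seq (get 13 2 8) (Seq (get 14 3 8)
     (IfNZ 11
       (IfNZ 12 Skip (Seq (Add 11 11 14) (Seq (Sub 11 11 13) (put 4 10 11))))
       (IfNZ 12 (Seq (Add 12 12 13) (Seq (Sub 12 12 14) (put 4 9 12))) Skip)))))))"

fun relax_abs :: "nat \<Rightarrow> abs_state \<Rightarrow> abs_state" where
  "relax_abs e (A, i, out) =
     (if A 4 (A 0 e) \<noteq> 0 \<and> A 4 (A 1 e) = 0
      then A(4 := (A 4)(A 1 e := A 4 (A 0 e) + A 3 e - A 2 e))
      else if A 4 (A 0 e) = 0 \<and> A 4 (A 1 e) \<noteq> 0
      then A(4 := (A 4)(A 0 e := A 4 (A 1 e) + A 2 e - A 3 e))
      else A, i, out)"

text \<open>The longest branch: six reads and one write of 6 steps each, two tests and two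
  arithmetic instructions.\<close>

lemma does_relax: "does 9 relax_prog 46 s (relax_abs (mem s 8) (abs_of s))"
  by (simp add: does_def relax_prog_def abs_of_def)

text \<open>The sum of the two truncated differences is the distance of the numbers, hence 0 exactly
  on equality.\<close>

definition eq_test :: "nat \<Rightarrow> nat \<Rightarrow> ram_prog" where
  "eq_test r j = Seq (Sub 20 j 7) (Seq (Sub r 7 j) (Add r r 20))"

text \<open>An edge that keeps the current vertex from being a source (a sink, if \<open>b\<close>
  is \<open>False\<close>) clears the flag. In \<open>put 5 0 0\<close> register 0, which holds 0,
  is both index and value.\<close>

definition scan_prog :: "bool \<Rightarrow> ram_prog" where
  "scan_prog b = Seq (get 9 2 8)
     (Seq (if b then IfNZ 9 (get 10 1 8) (get 10 0 8) else IfNZ 9 (get 10 0 8) (get 10 1 8))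
     (Seq (eq_test 11 10) (IfNZ 11 Skip (put 5 0 0))))"

fun scan_abs :: "bool \<Rightarrow> nat \<Rightarrow> nat \<Rightarrow> abs_state \<Rightarrow> abs_state" where
  "scan_abs b v e (A, i, out) =
     (if (if (A 2 e \<noteq> 0) = b then A 1 e else A 0 e) = v then A(5 := (A 5)(0 := 0)) else A, i, out)"

lemma does_scan:
  assumes "mem s 0 = 0"
  shows "does 9 (scan_prog b) 23 s (scan_abs b (mem s 7) (mem s 8) (abs_of s))"
  using assms by (cases b) (simp_all add: does_def scan_prog_def eq_test_def abs_of_def)

definition reverse_prog :: ram_prog where
  "reverse_prog = Seq (get 9 2 8) (Seq (Sub 9 1 9)
     (Seq (get 10 0 8) (Seq (eq_test 11 10) (Seq (get 10 1 8) (Seq (eq_test 12 10)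
     (IfNZ 11 (IfNZ 12 Skip (put 2 8 9)) (put 2 8 9)))))))"

fun reverse_abs :: "nat \<Rightarrow> nat \<Rightarrow> abs_state \<Rightarrow> abs_state" where
  "reverse_abs v e (A, i, out) =
     (if A 0 e = v \<or> A 1 e = v then A(2 := (A 2)(e := 1 - A 2 e)) else A, i, out)"

lemma does_reverse:
  assumes "mem s 1 = 1"
  shows "does 9 reverse_prog 33 s (reverse_abs (mem s 7) (mem s 8) (abs_of s))"
  using assms by (simp add: does_def reverse_prog_def eq_test_def abs_of_def)

text \<open>For a first part that leaves its result in a scratch register: \<open>does\<close> would
  forget this value before the second part can use it.\<close>

lemma does_Seq_wp:
  assumes "wp P (\<lambda>t s'. t \<le> T \<and> (\<forall>i<L. mem s' i = mem s i) \<and> does L R T' s' B) 0 s"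
  shows "does L (Seq P R) (T + T') s B"
proof -
  obtain t s' where 1: "ram_exec P s t s'" "t \<le> T" "\<forall>i<L. mem s' i = mem s i" "does L R T' s' B"
    using assms by (auto simp: wp_def)
  obtain t' s'' where 2: "ram_exec R s' t' s''" "t' \<le> T'" "\<forall>i<L. mem s'' i = mem s' i" "abs_of s'' = B"
    using 1(4) by (auto simp: does_iff)
  show ?thesis unfolding does_iff
    using 1 2 by (intro exI[of _ "t + t'"] exI[of _ s'']) (auto intro: ram_exec.Seq)
qed

text \<open>Truncated subtraction makes the initial flag the positive or the negative part of the
  potential, so it is nonzero exactly if the sign asks for a flip of this kind.\<close>

definition start_prog :: "bool \<Rightarrow> ram_prog" where
  "start_prog b = Seq (get 9 4 7) (Seq (if b then Sub 9 9 2 else Sub 9 2 9) (put 5 0 9))"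

fun start_abs :: "nat \<Rightarrow> bool \<Rightarrow> nat \<Rightarrow> abs_state \<Rightarrow> abs_state" where
  "start_abs n b v (A, i, out) = (A(5 := (A 5)(0 := if b then A 4 v - n else n - A 4 v)), i, out)"

lemma does_start:
  assumes "mem s 0 = 0"
  shows "does 8 (start_prog b) 13 s (start_abs (mem s 2) b (mem s 7) (abs_of s))"
  using assms by (cases b) (simp_all add: does_def start_prog_def abs_of_def)

definition finish_prog :: "bool \<Rightarrow> ram_prog" where
  "finish_prog b = Seq (Print 7) (Seq (get 9 4 7) (Seq (if b then Sub 9 9 1 else Add 9 9 1) (put 4 7 9)))"

fun finish_abs :: "bool \<Rightarrow> nat \<Rightarrow> abs_state \<Rightarrow> abs_state" where
  "finish_abs b v (A, i, out) =
     (A(4 := (A 4)(v := if b then A 4 v - 1 else A 4 v + 1)), i, out @ [v])"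

lemma does_finish:
  assumes "mem s 1 = 1"
  shows "does 8 (finish_prog b) 14 s (finish_abs b (mem s 7) (abs_of s))"
  using assms by (cases b) (simp_all add: does_def finish_prog_def abs_of_def)

definition try_prog :: "bool \<Rightarrow> ram_prog" where
  "try_prog b = Seq (start_prog b) (Seq (for_loop 8 3 (scan_prog b))
     (Seq (get 9 5 0) (IfNZ 9 (Seq (for_loop 8 3 reverse_prog) (finish_prog b)) Skip)))"

definition try_abs :: "nat \<Rightarrow> nat \<Rightarrow> bool \<Rightarrow> nat \<Rightarrow> abs_state \<Rightarrow> abs_state" where
  "try_abs n m b v a = (let a' = fold (scan_abs b v) [0..<m] (start_abs n b v a)
     in if fst a' 5 0 \<noteq> 0 then finish_abs b v (fold (reverse_abs v) [0..<m] a') else a')"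

lemma fst_abs_of [simp]: "fst (abs_of s) = arrays s"
  by (simp add: abs_of_def)

lemma abs_of_clobber [simp]: "abs_of (clobber a x s) = abs_of s"
  by (simp add: abs_of_def)

text \<open>Per edge, scanning takes 23 and reversing 33 steps, each with 3 more for the loop; 40
  collects everything outside the two loop bodies.\<close>

lemma does_try:
  assumes "mem s 0 = 0" "mem s 1 = 1"
  shows "does 8 (try_prog b) (mem s 3 * 62 + 40) s (try_abs (mem s 2) (mem s 3) b (mem s 7) (abs_of s))"
proof -
  let ?n = "mem s 2" and ?m = "mem s 3" and ?v = "mem s 7"
  define a1 where "a1 = start_abs ?n b ?v (abs_of s)"
  define a2 where "a2 = fold (scan_abs b ?v) [0..<?m] a1"
  define B where "B = try_abs ?n ?m b ?v (abs_of s)"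
  have B: "B = (if fst a2 5 0 \<noteq> 0 then finish_abs b ?v (fold (reverse_abs ?v) [0..<?m] a2) else a2)"
    by (simp add: B_def try_abs_def a2_def a1_def Let_def)
  have flip: "does 8 (Seq (for_loop 8 3 reverse_prog) (finish_prog b)) ((?m * 36 + 3) + 14) r
      (finish_abs b ?v (fold (reverse_abs ?v) [0..<?m] a2))"
    if r: "\<forall>i<8. mem r i = mem s i" "abs_of r = a2" for r
  proof (rule does_Seq)
    have "does 8 (for_loop 8 3 reverse_prog) (mem r 3 * (33 + 3) + 3) r
        (fold (reverse_abs ?v) [0..<mem r 3] (abs_of r))"
    proof (rule does_for_loop)
      fix j and r' :: ram_state assume "\<forall>l<8. mem r' l = mem r l" "mem r' 8 = j"
      then show "does (Suc 8) reverse_prog 33 r' (reverse_abs ?v j (abs_of r'))"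
        using does_reverse[of r'] r assms by simp
    qed (use r assms in simp_all)
    then show "does 8 (for_loop 8 3 reverse_prog) (?m * 36 + 3) r (fold (reverse_abs ?v) [0..<?m] a2)"
      using r by simp
  next
    fix r' assume "\<forall>i<8. mem r' i = mem r i" "abs_of r' = fold (reverse_abs ?v) [0..<?m] a2"
    then show "does 8 (finish_prog b) 14 r' (finish_abs b ?v (fold (reverse_abs ?v) [0..<?m] a2))"
      using does_finish[of r' b] r assms by simp
  qed
  have branch: "does 8 (Seq (get 9 5 0) (IfNZ 9 (Seq (for_loop 8 3 reverse_prog) (finish_prog b)) Skip))
      (6 + ((?m * 36 + 3) + 14 + 1)) r B" if r: "\<forall>i<8. mem r i = mem s i" "abs_of r = a2" for r
  proof (rule does_Seq_wp)
    define r1 where "r1 = set_mem 9 (arrays r 5 0) (clobber 5 0 r)"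
    have r1: "\<forall>i<8. mem r1 i = mem s i" "abs_of r1 = a2" "mem r1 9 = fst a2 5 0"
      using r fst_abs_of[of r] by (simp_all add: r1_def)
    have "does 8 (IfNZ 9 (Seq (for_loop 8 3 reverse_prog) (finish_prog b)) Skip) ((?m * 36 + 3) + 14 + 1) r1 B"
    proof (rule does_IfNZ)
      assume "mem r1 9 \<noteq> 0"
      then show "does 8 (Seq (for_loop 8 3 reverse_prog) (finish_prog b)) (?m * 36 + 3 + 14) r1 B"
        using flip[OF r1(1,2)] r1(3) by (simp add: B)
    next
      assume "mem r1 9 = 0"
      then show "does 8 Skip (?m * 36 + 3 + 14) r1 B" using r1 by (simp add: does_def B)
    qed
    then show "wp (get 9 5 0) (\<lambda>t s'. t \<le> 6 \<and> (\<forall>i<8. mem s' i = mem r i) \<and>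
        does 8 (IfNZ 9 (Seq (for_loop 8 3 reverse_prog) (finish_prog b)) Skip) (?m * 36 + 3 + 14 + 1) s' B) 0 r"
      using r assms by (simp add: r1_def)
  qed
  have scan: "does 8 (for_loop 8 3 (scan_prog b)) (?m * 26 + 3) r a2"
    if r: "\<forall>i<8. mem r i = mem s i" "abs_of r = a1" for r
  proof -
    have "does 8 (for_loop 8 3 (scan_prog b)) (mem r 3 * (23 + 3) + 3) r
        (fold (scan_abs b ?v) [0..<mem r 3] (abs_of r))"
    proof (rule does_for_loop)
      fix j and r' :: ram_state assume "\<forall>l<8. mem r' l = mem r l" "mem r' 8 = j"
      then show "does (Suc 8) (scan_prog b) 23 r' (scan_abs b ?v j (abs_of r'))"
        using does_scan[of r' b] r assms by simp
    qed (use r assms in simp_all)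
    then show ?thesis using r by (simp add: a2_def)
  qed
  have "does 8 (try_prog b) (13 + ((?m * 26 + 3) + (6 + ((?m * 36 + 3) + 14 + 1)))) s B"
    unfolding try_prog_def
    by (rule does_Seq[OF does_start[OF assms(1)]], rule does_Seq[OF scan branch]) (simp_all add: a1_def)
  then show ?thesis unfolding B_def by (rule does_mono) simp_all
qed

text \<open>Registers 0 to 4 hold 0, 1, the number of vertices, the number of edges and the root; the
  registers 5, 6, 7 (current vertex) and 8 (current edge) are loop counters. Arrays 0 and 1 hold the
  ends of the edges, 2 and 3 the orientations, 4 the shifted potential, and entry 0 of array 5 is a
  flag telling whether the current vertex is to be flipped.

  Instead of testing for termination, the greedy loop makes as many passes as the sum of the
  absolute values of the potential can require.\<close>

definition main_prog :: ram_prog where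
  "main_prog = Seq (Const 1 1) (Seq (Read 2) (Seq (Read 3) (Seq (Read 4)
     (Seq (for_loop 8 3 (Seq (read_prog 0) (read_prog 1)))
     (Seq (for_loop 8 3 (read_prog 2)) (Seq (for_loop 8 3 (read_prog 3)) (Seq (put 4 4 2)
     (Seq (for_loop 5 2 (for_loop 8 3 relax_prog))
       (for_loop 5 2 (for_loop 6 2 (for_loop 7 2 (Seq (try_prog True) (try_prog False)))))))))))))"

definition input_abs :: "nat \<Rightarrow> nat list \<Rightarrow> abs_state" where
  "input_abs m xs = fold (read_abs 3) [0..<m] (fold (read_abs 2) [0..<m]
     (fold (\<lambda>e a. read_abs 1 e (read_abs 0 e a)) [0..<m] (\<lambda>_ _. 0, xs, [])))"

text \<open>The potential is 0 at the root, which in shifted form is \<open>n\<close>.\<close>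

fun root_abs :: "nat \<Rightarrow> nat \<Rightarrow> abs_state \<Rightarrow> abs_state" where
  "root_abs n r (A, i, out) = (A(4 := (A 4)(r := n)), i, out)"

definition relax_all_abs :: "nat \<Rightarrow> nat \<Rightarrow> abs_state \<Rightarrow> abs_state" where
  "relax_all_abs n m = fold (\<lambda>_. fold relax_abs [0..<m]) [0..<n]"

definition pass_abs :: "nat \<Rightarrow> nat \<Rightarrow> abs_state \<Rightarrow> abs_state" where
  "pass_abs n m = fold (\<lambda>v a. try_abs n m False v (try_abs n m True v a)) [0..<n]"

definition passes_abs :: "nat \<Rightarrow> nat \<Rightarrow> abs_state \<Rightarrow> abs_state" where
  "passes_abs n m = fold (\<lambda>_. fold (\<lambda>_. pass_abs n m) [0..<n]) [0..<n]"

definition frame :: "nat \<Rightarrow> nat \<Rightarrow> ram_state \<Rightarrow> bool" where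
  "frame n m s \<longleftrightarrow> mem s 0 = 0 \<and> mem s 1 = 1 \<and> mem s 2 = n \<and> mem s 3 = m"

lemma frame_cong: "frame n m s \<Longrightarrow> \<forall>i<L. mem s' i = mem s i \<Longrightarrow> 4 \<le> L \<Longrightarrow> frame n m s'"
  by (auto simp: frame_def)

lemma does_for_frame:
  assumes s: "frame n m s" and i: "4 \<le> i" "i < 21" and k: "(k, K) = (2, n) \<or> (k, K) = (3, m)"
    and body: "\<And>j r. frame n m r \<Longrightarrow> \<forall>l<i. mem r l = mem s l \<Longrightarrow> mem r i = j \<Longrightarrow>
      does (Suc i) P T r (f j (abs_of r))"
  shows "does i (for_loop i k P) (K * (T + 3) + 3) s (fold f [0..<K] (abs_of s))"
proof -
  have K: "mem s k = K" "k < i" using s k i by (auto simp: frame_def)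
  have "does i (for_loop i k P) (mem s k * (T + 3) + 3) s (fold f [0..<mem s k] (abs_of s))"
    by (rule does_for_loop) (use s i K body frame_cong[OF s _ i(1)] in \<open>auto simp: frame_def\<close>)
  then show ?thesis by (simp add: K)
qed

text \<open>This and the next two bounds copy the nesting of the loops unsimplified, so that they
  match the loop rule and are visibly polynomial.\<close>

definition read_time :: "nat \<Rightarrow> nat" where
  "read_time m = (m * 17 + 3) + ((m * 10 + 3) + (m * 10 + 3))"

definition relax_time :: "nat \<Rightarrow> nat \<Rightarrow> nat" where
  "relax_time n m = n * ((m * 49 + 3) + 3) + 3"

definition passes_time :: "nat \<Rightarrow> nat \<Rightarrow> nat" where
  "passes_time n m = n * ((n * ((n * ((m * 62 + 40 + (m * 62 + 40)) + 3) + 3) + 3) + 3) + 3) + 3"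

lemma does_relax_all:
  assumes s: "frame n m s"
  shows "does 5 (for_loop 5 2 (for_loop 8 3 relax_prog)) (relax_time n m) s (relax_all_abs n m (abs_of s))"
  unfolding relax_all_abs_def relax_time_def
proof (rule does_for_frame[OF s])
  fix j and r :: ram_state assume r: "frame n m r"
  have "does 8 (for_loop 8 3 relax_prog) (m * (46 + 3) + 3) r (fold relax_abs [0..<m] (abs_of r))"
  proof (rule does_for_frame[OF r])
    fix j and r' :: ram_state assume "mem r' 8 = j"
    then show "does (Suc 8) relax_prog 46 r' (relax_abs j (abs_of r'))" using does_relax[of r'] by simp
  qed simp_all
  then show "does (Suc 5) (for_loop 8 3 relax_prog) (m * 49 + 3) r (fold relax_abs [0..<m] (abs_of r))"
    by (rule does_mono) simp_all
qed simp_all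

lemma does_passes:
  assumes s: "frame n m s"
  shows "does 5 (for_loop 5 2 (for_loop 6 2 (for_loop 7 2 (Seq (try_prog True) (try_prog False)))))
    (passes_time n m) s (passes_abs n m (abs_of s))"
  unfolding passes_abs_def passes_time_def
proof (rule does_for_frame[OF s])
  fix j1 and r1 :: ram_state assume r1: "frame n m r1"
  have "does 6 (for_loop 6 2 (for_loop 7 2 (Seq (try_prog True) (try_prog False))))
      (n * ((n * ((m * 62 + 40 + (m * 62 + 40)) + 3) + 3) + 3) + 3) r1
      (fold (\<lambda>_. pass_abs n m) [0..<n] (abs_of r1))"
  proof (rule does_for_frame[OF r1])
    fix j2 and r2 :: ram_state assume r2: "frame n m r2"
    have "does 7 (for_loop 7 2 (Seq (try_prog True) (try_prog False)))
        (n * ((m * 62 + 40 + (m * 62 + 40)) + 3) + 3) r2 (pass_abs n m (abs_of r2))"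
      unfolding pass_abs_def
    proof (rule does_for_frame[OF r2])
      fix v and r3 :: ram_state assume r3: "frame n m r3" "mem r3 7 = v"
      have att: "does (Suc 7) (try_prog b) (m * 62 + 40) r (try_abs n m b v (abs_of r))"
        if "frame n m r" "mem r 7 = v" for b r
        using does_try[of r b] that by (simp add: frame_def)
      show "does (Suc 7) (Seq (try_prog True) (try_prog False)) (m * 62 + 40 + (m * 62 + 40)) r3
          (try_abs n m False v (try_abs n m True v (abs_of r3)))"
      proof (rule does_Seq[OF att[OF r3]])
        fix r4 assume r4: "\<forall>i<Suc 7. mem r4 i = mem r3 i" "abs_of r4 = try_abs n m True v (abs_of r3)"
        then have "frame n m r4" "mem r4 7 = v" using frame_cong[OF r3(1) r4(1)] r3(2) by simp_all
        from att[OF this] r4(2) show "does (Suc 7) (try_prog False) (m * 62 + 40) r4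
            (try_abs n m False v (try_abs n m True v (abs_of r3)))" by simp
      qed
    qed simp_all
    then show "does (Suc 6) (for_loop 7 2 (Seq (try_prog True) (try_prog False)))
        (n * ((m * 62 + 40 + (m * 62 + 40)) + 3) + 3) r2 (pass_abs n m (abs_of r2))" by simp
  qed simp_all
  then show "does (Suc 5) (for_loop 6 2 (for_loop 7 2 (Seq (try_prog True) (try_prog False))))
      (n * ((n * ((m * 62 + 40 + (m * 62 + 40)) + 3) + 3) + 3) + 3) r1
      (fold (\<lambda>_. pass_abs n m) [0..<n] (abs_of r1))" by simp
qed simp_all

text \<open>Holds for arbitrary input numbers; graphs only enter afterwards. The 4 steps are the
  initial constant and the three header reads, the 6 steps the write at the root.\<close>

lemma main_prog_correct:
  "\<exists>t. ram_computes main_prog (n # m # r # xs) t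
       (snd (snd (passes_abs n m (relax_all_abs n m (root_abs n r (input_abs m xs)))))) \<and>
     t \<le> 4 + (read_time m + (6 + (relax_time n m + passes_time n m)))"
proof -
  define s0 where "s0 = \<lparr>mem = (\<lambda>_. 0), inp = n # m # r # xs, outp = []\<rparr>"
  define B where "B = passes_abs n m (relax_all_abs n m (root_abs n r (input_abs m xs)))"
  have read: "does 8 (for_loop 8 3 (read_prog a)) (m * 10 + 3) s (fold (read_abs a) [0..<m] (abs_of s))"
    if s: "frame n m s" and a: "a < 8" for a s
  proof -
    have "does 8 (for_loop 8 3 (read_prog a)) (m * (7 + 3) + 3) s (fold (read_abs a) [0..<m] (abs_of s))"
    proof (rule does_for_frame[OF s])
      fix j and r' :: ram_state assume "mem r' 8 = j"
      then show "does (Suc 8) (read_prog a) 7 r' (read_abs a j (abs_of r'))" using does_read[OF a, of r'] by simp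
    qed simp_all
    then show ?thesis by simp
  qed
  have read2: "does 8 (for_loop 8 3 (Seq (read_prog 0) (read_prog 1))) (m * 17 + 3) s
      (fold (\<lambda>e a. read_abs 1 e (read_abs 0 e a)) [0..<m] (abs_of s))" if s: "frame n m s" for s
  proof -
    have "does 8 (for_loop 8 3 (Seq (read_prog 0) (read_prog 1))) (m * ((7 + 7) + 3) + 3) s
        (fold (\<lambda>e a. read_abs 1 e (read_abs 0 e a)) [0..<m] (abs_of s))"
    proof (rule does_for_frame[OF s])
      fix j and r' :: ram_state assume r': "mem r' 8 = j"
      have "does 9 (Seq (read_prog 0) (read_prog 1)) (7 + 7) r'
          (read_abs 1 (mem r' 8) (read_abs 0 (mem r' 8) (abs_of r')))"
      proof (rule does_Seq[OF does_read])
        fix r'' assume "\<forall>i<9. mem r'' i = mem r' i" "abs_of r'' = read_abs 0 (mem r' 8) (abs_of r')"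
        then show "does 9 (read_prog 1) 7 r'' (read_abs 1 (mem r' 8) (read_abs 0 (mem r' 8) (abs_of r')))"
          using does_read[of 1 r''] by simp
      qed simp
      then show "does (Suc 8) (Seq (read_prog 0) (read_prog 1)) (7 + 7) r'
          (read_abs 1 j (read_abs 0 j (abs_of r')))" using r' by simp
    qed simp_all
    then show ?thesis by simp
  qed
  define R where "R = Seq (for_loop 8 3 (Seq (read_prog 0) (read_prog 1)))
     (Seq (for_loop 8 3 (read_prog 2)) (Seq (for_loop 8 3 (read_prog 3)) (Seq (put 4 4 2)
     (Seq (for_loop 5 2 (for_loop 8 3 relax_prog))
       (for_loop 5 2 (for_loop 6 2 (for_loop 7 2 (Seq (try_prog True) (try_prog False)))))))))"
  define a1 where "a1 = fold (\<lambda>e a. read_abs 1 e (read_abs 0 e a)) [0..<m] (\<lambda>_ _. 0, xs, [])"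
  define a2 where "a2 = fold (read_abs 2) [0..<m] a1"
  define a3 where "a3 = fold (read_abs 3) [0..<m] a2"
  have B: "B = passes_abs n m (relax_all_abs n m (root_abs n r a3))"
    by (simp add: B_def input_abs_def a1_def a2_def a3_def)
  define T where "T = (m * 17 + 3) + ((m * 10 + 3) + ((m * 10 + 3) + (6 + (relax_time n m + passes_time n m))))"
  have R: "does 5 R T s B" if s: "frame n m s" "mem s 4 = r" "abs_of s = (\<lambda>_ _. 0, xs, [])" for s
    unfolding R_def T_def
  proof (rule does_Seq)
    show "does 5 (for_loop 8 3 (Seq (read_prog 0) (read_prog 1))) (m * 17 + 3) s a1"
      using does_mono[OF read2[OF s(1)]] s(3) by (simp add: a1_def)
    fix s1 assume *: "\<forall>i<5. mem s1 i = mem s i" "abs_of s1 = a1"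
    have s1: "frame n m s1" "mem s1 4 = r" "abs_of s1 = a1"
      using frame_cong[OF s(1) *(1)] * s(2) by simp_all
    show "does 5 (Seq (for_loop 8 3 (read_prog 2)) (Seq (for_loop 8 3 (read_prog 3)) (Seq (put 4 4 2)
        (Seq (for_loop 5 2 (for_loop 8 3 relax_prog))
        (for_loop 5 2 (for_loop 6 2 (for_loop 7 2 (Seq (try_prog True) (try_prog False)))))))))
        ((m * 10 + 3) + ((m * 10 + 3) + (6 + (relax_time n m + passes_time n m)))) s1 B"
    proof (rule does_Seq)
      show "does 5 (for_loop 8 3 (read_prog 2)) (m * 10 + 3) s1 a2"
        using does_mono[OF read[OF s1(1), of 2]] s1(3) by (simp add: a2_def)
      fix s2 assume *: "\<forall>i<5. mem s2 i = mem s1 i" "abs_of s2 = a2"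
      have s2: "frame n m s2" "mem s2 4 = r" "abs_of s2 = a2"
        using frame_cong[OF s1(1) *(1)] * s1(2) by simp_all
      show "does 5 (Seq (for_loop 8 3 (read_prog 3)) (Seq (put 4 4 2)
          (Seq (for_loop 5 2 (for_loop 8 3 relax_prog))
          (for_loop 5 2 (for_loop 6 2 (for_loop 7 2 (Seq (try_prog True) (try_prog False))))))))
          ((m * 10 + 3) + (6 + (relax_time n m + passes_time n m))) s2 B"
      proof (rule does_Seq)
        show "does 5 (for_loop 8 3 (read_prog 3)) (m * 10 + 3) s2 a3"
          using does_mono[OF read[OF s2(1), of 3]] s2(3) by (simp add: a3_def)
        fix s3 assume *: "\<forall>i<5. mem s3 i = mem s2 i" "abs_of s3 = a3"
        have s3: "frame n m s3" "mem s3 4 = r" "abs_of s3 = a3"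
          using frame_cong[OF s2(1) *(1)] * s2(2) by simp_all
        show "does 5 (Seq (put 4 4 2) (Seq (for_loop 5 2 (for_loop 8 3 relax_prog))
            (for_loop 5 2 (for_loop 6 2 (for_loop 7 2 (Seq (try_prog True) (try_prog False)))))))
            (6 + (relax_time n m + passes_time n m)) s3 B"
        proof (rule does_Seq)
          show "does 5 (put 4 4 2) 6 s3 (root_abs n r a3)"
            using s3 by (cases a3) (simp add: does_def abs_of_def frame_def)
          fix s4 assume *: "\<forall>i<5. mem s4 i = mem s3 i" "abs_of s4 = root_abs n r a3"
          have s4: "frame n m s4" using frame_cong[OF s3(1) *(1)] by simp
          show "does 5 (Seq (for_loop 5 2 (for_loop 8 3 relax_prog))
              (for_loop 5 2 (for_loop 6 2 (for_loop 7 2 (Seq (try_prog True) (try_prog False))))))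
              (relax_time n m + passes_time n m) s4 B"
          proof (rule does_Seq[OF does_relax_all[OF s4]])
            fix s5 assume **: "\<forall>i<5. mem s5 i = mem s4 i" "abs_of s5 = relax_all_abs n m (abs_of s4)"
            have "frame n m s5" using frame_cong[OF s4 **(1)] by simp
            from does_passes[OF this] show "does 5
              (for_loop 5 2 (for_loop 6 2 (for_loop 7 2 (Seq (try_prog True) (try_prog False)))))
              (passes_time n m) s5 B" using ** * by (simp add: B)
          qed
        qed
      qed
    qed
  qed
  define s1 where "s1 = set_mem 4 r (set_mem 3 m (set_mem 2 n (set_mem 1 1 (s0\<lparr>inp := xs\<rparr>))))"
  have wp: "wp main_prog Q 0 s0 \<longleftrightarrow> wp R Q 4 s1" for Q
  proof -
    have main: "main_prog = Seq (Const 1 1) (Seq (Read 2) (Seq (Read 3) (Seq (Read 4) R)))"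
      by (simp only: main_prog_def R_def)
    have four: "Suc (Suc (Suc (Suc 0))) = 4" by simp
    show ?thesis by (simp add: four main s0_def s1_def set_mem_def)
  qed
  have "frame n m s1" "mem s1 4 = r" by (simp_all add: frame_def s1_def s0_def)
  moreover have "arrays s0 = (\<lambda>_ _. 0)"
    by (simp add: arrays_def s0_def fun_eq_iff del: mem_cell)
  then have "abs_of s1 = (\<lambda>_ _. 0, xs, [])" by (simp add: abs_of_def s1_def) (simp add: s0_def)
  ultimately obtain t s' where t: "ram_exec R s1 t s'" "t \<le> T" "abs_of s' = B"
    using R[of s1] by (auto simp: does_iff)
  then have "wp main_prog (\<lambda>c s. c \<le> 4 + T \<and> abs_of s = B) 0 s0"
    unfolding wp by (auto simp: wp_def)
  then obtain t s' where "ram_exec main_prog s0 t s'" "t \<le> 4 + T" "abs_of s' = B"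
    by (auto simp: wp_def)
  then show ?thesis
    unfolding ram_computes_def s0_def[symmetric] B_def[symmetric]
    by (intro exI[of _ t]) (auto simp: T_def read_time_def abs_of_def)
qed

section \<open>Correctness of the program\<close>

lemma fold_read:
  "length us = k \<Longrightarrow> fold (read_abs a) [0..<k] (A, us @ rest, out) =
     (A(a := \<lambda>e. if e < k then us ! e else A a e), rest, out)"
proof (induction k arbitrary: us rest)
  case (Suc k)
  then obtain vs x where us: "us = vs @ [x]" "length vs = k" by (metis length_Suc_conv_rev)
  show ?case using Suc.IH[OF us(2), of "x # rest"] us(2)
    by (auto simp: us(1) fun_eq_iff nth_append less_Suc_eq)
qed simp

lemma fold_read_edges:
  "fold (\<lambda>e a. read_abs 1 e (read_abs 0 e a)) [0..<length E] (A, concat (map (\<lambda>(u, v). [u, v]) E) @ rest, out) =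
     (A(0 := \<lambda>e. if e < length E then fst (E ! e) else A 0 e,
        1 := \<lambda>e. if e < length E then snd (E ! e) else A 1 e), rest, out)"
proof (induction E arbitrary: rest rule: rev_induct)
  case (snoc x E)
  obtain u v where x: "x = (u, v)" by fastforce
  show ?case using snoc.IH[of "u # v # rest"]
    by (auto simp: x fun_eq_iff nth_append less_Suc_eq)
qed simp

lemma input_abs_encode:
  assumes "length X = length (edges G)" "length Y = length (edges G)"
  obtains A where
    "input_abs (length (edges G)) (concat (map (\<lambda>(u, v). [u, v]) (edges G)) @ map of_bool X @ map of_bool Y)
      = (A, [], [])"
    "\<And>e. e < length (edges G) \<Longrightarrow> A 0 e = fst (edges G ! e) \<and> A 1 e = snd (edges G ! e) \<and>
       A 2 e = of_bool (X ! e) \<and> A 3 e = of_bool (Y ! e)"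
    "\<And>v. A 4 v = 0"
proof -
  let ?m = "length (edges G)"
  define A0 :: "nat \<Rightarrow> nat \<Rightarrow> nat" where "A0 = (\<lambda>_ _. 0)"
  define A1 where "A1 = A0(0 := \<lambda>e. if e < ?m then fst (edges G ! e) else A0 0 e,
        1 := \<lambda>e. if e < ?m then snd (edges G ! e) else A0 1 e)"
  define A2 where "A2 = A1(2 := \<lambda>e. if e < ?m then map of_bool X ! e else A1 2 e)"
  define A3 where "A3 = A2(3 := \<lambda>e. if e < ?m then map of_bool Y ! e else A2 3 e)"
  have "fold (read_abs 3) [0..<?m] (A2, map of_bool Y @ [], []) = (A3, [], [])"
    unfolding A3_def by (rule fold_read) (simp add: assms)
  moreover have "fold (read_abs 2) [0..<?m] (A1, map of_bool X @ map of_bool Y, []) = (A2, map of_bool Y, [])"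
    unfolding A2_def by (rule fold_read) (simp add: assms)
  moreover have "fold (\<lambda>e a. read_abs 1 e (read_abs 0 e a)) [0..<?m]
      (A0, concat (map (\<lambda>(u, v). [u, v]) (edges G)) @ map of_bool X @ map of_bool Y, [])
      = (A1, map of_bool X @ map of_bool Y, [])"
    unfolding A1_def by (rule fold_read_edges)
  ultimately have "input_abs ?m (concat (map (\<lambda>(u, v). [u, v]) (edges G)) @ map of_bool X @ map of_bool Y)
      = (A3, [], [])"
    by (simp add: input_abs_def A0_def)
  then show thesis
    by (rule that) (use assms in \<open>auto simp: A0_def A1_def A2_def A3_def\<close>)
qed

section \<open>Computing the potential by relaxation\<close>

fun graph_arrays :: "mgraph \<Rightarrow> orientation \<Rightarrow> abs_state \<Rightarrow> bool" where
  "graph_arrays G X (A, i, out) \<longleftrightarrow> (\<forall>e < length (edges G).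
     A 0 e = fst (edges G ! e) \<and> A 1 e = snd (edges G ! e) \<and> A 2 e = of_bool (X ! e))"

text \<open>Array 4 stores the potential shifted by the number of vertices, which makes it positive;
  0 stands for a vertex that has not been reached yet.\<close>

fun relax_inv :: "mgraph \<Rightarrow> orientation \<Rightarrow> orientation \<Rightarrow> (nat \<Rightarrow> int) \<Rightarrow> abs_state \<Rightarrow> bool" where
  "relax_inv G X Y z (A, i, out) \<longleftrightarrow> graph_arrays G X (A, i, out) \<and> out = [] \<and>
     (\<forall>e < length (edges G). A 3 e = of_bool (Y ! e)) \<and>
     (\<forall>v < nverts G. A 4 v = 0 \<or> int (A 4 v) = z v + int (nverts G))"

abbreviation known :: "abs_state \<Rightarrow> nat \<Rightarrow> bool" where
  "known a v \<equiv> fst a 4 v \<noteq> 0"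

lemma relax_step:
  assumes wf: "wf_mgraph G" and pot: "potential G X Y z"
    and z: "\<forall>v < nverts G. \<bar>z v\<bar> < int (nverts G)"
    and inv: "relax_inv G X Y z a" and e: "e < length (edges G)"
  shows "relax_inv G X Y z (relax_abs e a)"
    and "known a v \<Longrightarrow> known (relax_abs e a) v"
    and "known a (fst (edges G ! e)) \<or> known a (snd (edges G ! e)) \<Longrightarrow>
      known (relax_abs e a) (fst (edges G ! e)) \<and> known (relax_abs e a) (snd (edges G ! e))"
proof -
  obtain A i out where a: "a = (A, i, out)" by (cases a)
  let ?u = "fst (edges G ! e)" and ?w = "snd (edges G ! e)"
  note uw = wf_mgraph_edge[OF wf e]
  have A: "A 0 e = ?u" "A 1 e = ?w" "A 2 e = of_bool (X ! e)" "A 3 e = of_bool (Y ! e)"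
    using inv e by (simp_all add: a)
  have zz: "z ?w = z ?u + of_bool (Y ! e) - of_bool (X ! e)"
    using pot[unfolded potential_def, rule_format, OF e] by linarith
  \<comment> \<open>Strict positivity makes the truncated subtractions in \<open>p\<close> and
    \<open>q\<close> exact and the new entries nonzero, hence recognisable as known.\<close>
  have pos: "z ?u + int (nverts G) > 0" "z ?w + int (nverts G) > 0" using z uw by force+
  have val: "int (A 4 v) = z v + int (nverts G)" if "v < nverts G" "A 4 v \<noteq> 0" for v
    using inv that by (auto simp: a)
  define p q where "p = A 4 ?u + of_bool (Y ! e) - of_bool (X ! e)"
    and "q = A 4 ?w + of_bool (X ! e) - of_bool (Y ! e)"
  have p: "int p = z ?w + int (nverts G)" if "A 4 ?u \<noteq> 0"
    using val[OF uw(1) that] zz pos by (auto simp: p_def of_bool_def split: if_splits)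
  have q: "int q = z ?u + int (nverts G)" if "A 4 ?w \<noteq> 0"
    using val[OF uw(2) that] zz pos by (auto simp: q_def of_bool_def split: if_splits)
  define f where "f = (if A 4 ?u \<noteq> 0 \<and> A 4 ?w = 0 then (A 4)(?w := p)
    else if A 4 ?u = 0 \<and> A 4 ?w \<noteq> 0 then (A 4)(?u := q) else A 4)"
  have eq: "relax_abs e a = (A(4 := f), i, out)"
    by (simp add: a A f_def p_def q_def del: One_nat_def)
  have "f v = 0 \<or> int (f v) = z v + int (nverts G)" if "v < nverts G" for v
    using val[OF that] p q by (auto simp: f_def)
  then show "relax_inv G X Y z (relax_abs e a)"
    using inv unfolding eq by (simp add: a)
  show "known a v \<Longrightarrow> known (relax_abs e a) v"
    unfolding eq by (auto simp: a f_def)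
  have "A 4 ?u \<noteq> 0 \<Longrightarrow> p \<noteq> 0" "A 4 ?w \<noteq> 0 \<Longrightarrow> q \<noteq> 0"
    using p q pos by force+
  then show "known a ?u \<or> known a ?w \<Longrightarrow> known (relax_abs e a) ?u \<and> known (relax_abs e a) ?w"
    unfolding eq by (auto simp: a f_def)
qed

text \<open>Updates within a round can only help: known vertices stay known, so each edge treated
  passes on at least what was known when the round began.\<close>

lemma relax_round:
  assumes "wf_mgraph G" "potential G X Y z"
    and "\<forall>v < nverts G. \<bar>z v\<bar> < int (nverts G)"
    and "relax_inv G X Y z a" "k \<le> length (edges G)"
  shows "relax_inv G X Y z (fold relax_abs [0..<k] a) \<and>
    (\<forall>v. known a v \<longrightarrow> known (fold relax_abs [0..<k] a) v) \<and>
    (\<forall>e<k. known a (fst (edges G ! e)) \<or> known a (snd (edges G ! e)) \<longrightarrow>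
      known (fold relax_abs [0..<k] a) (fst (edges G ! e)) \<and>
      known (fold relax_abs [0..<k] a) (snd (edges G ! e)))"
  using assms(5)
proof (induction k)
  case (Suc k)
  define b where "b = fold relax_abs [0..<k] a"
  have b: "fold relax_abs [0..<Suc k] a = relax_abs k b" by (simp add: b_def)
  note IH = Suc.IH[folded b_def]
  have inv: "relax_inv G X Y z b" and k: "k < length (edges G)" using IH Suc.prems by simp_all
  note st = relax_step[OF assms(1-3) inv k]
  show ?case unfolding b
    using IH st Suc.prems by (auto simp del: relax_abs.simps relax_inv.simps simp: less_Suc_eq)
qed (use assms(4) in simp)

lemma fold_const_upt: "fold (\<lambda>_. f) [0..<n] = f ^^ n"
  by (induction n) simp_all

text \<open>After k rounds every vertex at the end of a walk of length at most k from
  \<open>r\<close> is known, and paths have length below \<open>nverts G\<close>.\<close>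

lemma relax_all:
  assumes wf: "wf_mgraph G" and con: "connected_mgraph G" and pot: "potential G X Y z"
    and z: "\<forall>v < nverts G. \<bar>z v\<bar> < int (nverts G)"
    and inv: "relax_inv G X Y z a" and r: "r < nverts G" "known a r"
  shows "relax_inv G X Y z (relax_all_abs (nverts G) (length (edges G)) a)"
    and "v < nverts G \<Longrightarrow> known (relax_all_abs (nverts G) (length (edges G)) a) v"
proof -
  interpret fin_digraph "dart_digraph G" by (rule fin_digraph_dart_digraph[OF wf])
  define F where "F = fold relax_abs [0..<length (edges G)]"
  have all: "relax_all_abs (nverts G) (length (edges G)) a = (F ^^ nverts G) a"
    by (simp add: relax_all_abs_def F_def fold_const_upt)
  note round = relax_round[OF wf pot z _ order_refl, folded F_def]
  have I: "relax_inv G X Y z ((F ^^ k) a)" for k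
    by (induction k) (use inv round in \<open>simp_all del: relax_inv.simps\<close>)
  have K: "known ((F ^^ k) a) v" if "awalk r p v" "length p \<le> k" for p v k
    using that
  proof (induction p arbitrary: v k rule: rev_induct)
    case Nil
    then have v: "v = r" by (simp add: awalk_Nil_iff)
    show ?case by (induction k) (use r v round[OF I] in simp_all)
  next
    case (snoc d p)
    then obtain k' where k: "k = Suc k'" "length p \<le> k'" by (cases k) auto
    from snoc.prems(1) obtain u where u: "awalk r p u" "awalk u [d] v"
      unfolding awalk_append_iff by blast
    then have d: "fst d < length (edges G)" "u = dart_tail G d" "v = dart_head G d"
      by (auto simp: awalk_Cons_iff awalk_Nil_iff)
    have "known ((F ^^ k') a) (dart_tail G d)" using snoc.IH[OF u(1) k(2)] d by simp
    then show ?case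
      using round[OF I[of k']] d by (cases d) (auto simp: k(1) split: if_splits)
  qed
  show "relax_inv G X Y z (relax_all_abs (nverts G) (length (edges G)) a)"
    unfolding all by (rule I)
  assume v: "v < nverts G"
  then obtain p where p: "apath r p v"
    using con r(1) reachable_apath[of r v] by (auto simp: connected_mgraph_def strongly_connected_def)
  show "known (relax_all_abs (nverts G) (length (edges G)) a) v"
    unfolding all by (rule K[OF awalkI_apath[OF p]]) (use length_apath_less[OF p] in simp)
qed

section \<open>Simulation of the greedy procedure\<close>

lemma fold_scan:
  "fold (scan_abs b v) [0..<k] (A, i, out) =
     (if \<exists>e<k. (if (A 2 e \<noteq> 0) = b then A 1 e else A 0 e) = v then A(5 := (A 5)(0 := 0)) else A, i, out)"
proof -
  define bad where "bad e \<longleftrightarrow> (if (A 2 e \<noteq> 0) = b then A 1 e else A 0 e) = v" for e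
  define A' where "A' = A(5 := (A 5)(0 := 0))"
  \<comment> \<open>A cleared flag stays cleared, so the scan amounts to an existential test without
    leaving the loop early.\<close>
  have step: "scan_abs b v e (A, i, out) = (if bad e then A' else A, i, out)"
    "scan_abs b v e (A', i, out) = (A', i, out)" for e
    by (simp_all add: A'_def bad_def)
  have "fold (scan_abs b v) [0..<k] (A, i, out) = (if \<exists>e<k. bad e then A' else A, i, out)"
  proof (induction k)
    case (Suc k)
    have "(\<exists>e<Suc k. bad e) \<longleftrightarrow> (\<exists>e<k. bad e) \<or> bad k" by (auto simp: less_Suc_eq)
    with Suc step show ?case by (auto simp del: scan_abs.simps)
  qed simp
  then show ?thesis by (simp only: bad_def A'_def)
qed

lemma fold_reverse:
  "fold (reverse_abs v) [0..<k] (A, i, out) =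
     (A(2 := \<lambda>e. if e < k \<and> (A 0 e = v \<or> A 1 e = v) then 1 - A 2 e else A 2 e), i, out)"
proof (induction k)
  case (Suc k)
  then show ?case by (auto simp: less_Suc_eq fun_eq_iff simp del: One_nat_def)
qed simp

fun represents :: "mgraph \<Rightarrow> greedy_state \<Rightarrow> abs_state \<Rightarrow> bool" where
  "represents G (X, z, ws) (A, i, out) \<longleftrightarrow> graph_arrays G X (A, i, out) \<and> out = ws \<and>
     (\<forall>v < nverts G. int (A 4 v) = z v + int (nverts G))"

text \<open>The flag in array 5 starts with the sign condition and is cleared by any edge pointing
  the wrong way; at the end it is nonzero exactly if \<open>wants_flip\<close> holds.\<close>

lemma represents_try_flip:
  assumes rep: "represents G s a" and len: "length (fst s) = length (edges G)" and v: "v < nverts G"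
    and z: "\<bar>fst (snd s) v\<bar> < int (nverts G)"
  shows "represents G (try_flip G b v s) (try_abs (nverts G) (length (edges G)) b v a)"
proof -
  obtain X zz ws where s: "s = (X, zz, ws)" by (cases s)
  obtain A i out where a: "a = (A, i, out)" by (cases a)
  let ?n = "nverts G" and ?m = "length (edges G)"
  have A: "A 0 e = fst (edges G ! e)" "A 1 e = snd (edges G ! e)" "A 2 e = of_bool (X ! e)"
    if "e < ?m" for e using rep that by (simp_all add: s a)
  have out: "out = ws" and A4: "int (A 4 u) = zz u + int ?n" if "u < ?n" for u
    using rep that by (simp_all add: s a)
  note out = out[OF v]
  define d where "d = (if b then A 4 v - ?n else ?n - A 4 v)"
  define bad where "bad \<longleftrightarrow> (\<exists>e<?m. (if (A 2 e \<noteq> 0) = b then A 1 e else A 0 e) = v)"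
  define A1 where "A1 = A(5 := (A 5)(0 := d))"
  define A2 where "A2 = (if bad then A1(5 := (A1 5)(0 := 0)) else A1)"
  have scan: "fold (scan_abs b v) [0..<?m] (start_abs ?n b v a) = (A2, i, out)"
  proof -
    have "start_abs ?n b v a = (A1, i, out)" by (simp add: a A1_def d_def)
    moreover have "(\<exists>e<?m. (if (A1 2 e \<noteq> 0) = b then A1 1 e else A1 0 e) = v) \<longleftrightarrow> bad"
      by (simp add: A1_def bad_def)
    ultimately show ?thesis by (simp only: fold_scan A2_def)
  qed
  have bad: "bad \<longleftrightarrow> \<not> flippable G X b v"
  proof -
    \<comment> \<open>The second end is the head exactly if the stored bit is 1, so comparing this
      bit with \<open>b\<close> selects the head for the source test and the tail for the sink
      test.\<close>
    have eq: "(if (A 2 e \<noteq> 0) = b then A 1 e else A 0 e) =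
      (if b then dart_head G (e, X ! e) else dart_tail G (e, X ! e))" if "e < ?m" for e
      using A[OF that] by (cases b; cases "X ! e") (simp_all del: One_nat_def)
    have "bad \<longleftrightarrow> (\<exists>e<?m. (if b then dart_head G (e, X ! e) else dart_tail G (e, X ! e)) = v)"
      unfolding bad_def by (rule iff_exI, rule conj_cong) (simp_all only: eq)
    then show ?thesis using v
      by (cases b) (simp_all add: flippable_def is_source_iff is_sink_iff del: dart_head.simps dart_tail.simps)
  qed
  have d: "d \<noteq> 0 \<longleftrightarrow> (if b then zz v > 0 else zz v < 0)"
    using A4[OF v] by (auto simp: d_def)
  have test: "A2 5 0 \<noteq> 0 \<longleftrightarrow> wants_flip G b v s"
    using bad d by (auto simp: A2_def A1_def s)
  have A2: "A2 j = A j" if "j \<noteq> 5" for j using that by (simp add: A2_def A1_def)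
  show ?thesis
  proof (cases "wants_flip G b v s")
    case False
    then have "try_abs ?n ?m b v a = (A2, i, out)" using test by (simp add: try_abs_def scan)
    moreover have "try_flip G b v s = s" using False by (simp add: s del: wants_flip.simps)
    ultimately show ?thesis using rep by (simp add: s a A2 del: One_nat_def)
  next
    case True
    define B where "B = A2(2 := \<lambda>e. if e < ?m \<and> (A2 0 e = v \<or> A2 1 e = v) then 1 - A2 2 e else A2 2 e,
      4 := (A2 4)(v := if b then A2 4 v - 1 else A2 4 v + 1))"
    have tr: "try_abs ?n ?m b v a = (B, i, out @ [v])"
      using True test by (simp add: try_abs_def scan fold_reverse B_def del: One_nat_def)
    have tf: "try_flip G b v s = (reverse_at G v X, zz(v := if b then zz v - 1 else zz v + 1), ws @ [v])"
      using True by (simp add: s del: wants_flip.simps)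
    have "B 0 e = fst (edges G ! e) \<and> B 1 e = snd (edges G ! e) \<and> B 2 e = of_bool (reverse_at G v X ! e)"
      if e: "e < ?m" for e
      using A[OF e] e len by (auto simp: B_def A2 s nth_reverse_at simp del: One_nat_def)
    moreover have "int (B 4 u) = (zz(v := if b then zz v - 1 else zz v + 1)) u + int ?n" if "u < ?n" for u
      using A4[OF that] True z by (auto simp: B_def A2 s)
    ultimately show ?thesis unfolding tr tf using out by simp
  qed
qed

lemma represents_pass:
  assumes wf: "wf_mgraph G" and inv: "greedy_inv G r X0 Y N s" and rep: "represents G s a"
  shows "represents G (greedy_pass G s) (pass_abs (nverts G) (length (edges G)) a)"
    and "greedy_inv G r X0 Y N (greedy_pass G s)"
proof -
  let ?F = "\<lambda>v s. try_flip G False v (try_flip G True v s)"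
    and ?H = "\<lambda>v a. try_abs (nverts G) (length (edges G)) False v (try_abs (nverts G) (length (edges G)) True v a)"
  have one: "represents G (try_flip G b v t) (try_abs (nverts G) (length (edges G)) b v c)"
    if "greedy_inv G r X0 Y N t" "represents G t c" "v < nverts G" for b v t c
    using that by (intro represents_try_flip) (cases t; auto)+
  have "greedy_inv G r X0 Y N (fold ?F vs s) \<and> represents G (fold ?F vs s) (fold ?H vs a)"
    if "set vs \<subseteq> {..<nverts G}" for vs
    using that
  proof (induction vs rule: rev_induct)
    case (snoc v vs)
    define t c where "t = fold ?F vs s" and "c = fold ?H vs a"
    have v: "v < nverts G" and t: "greedy_inv G r X0 Y N t" "represents G t c"
      using snoc by (auto simp: t_def c_def)
    note t1 = greedy_inv_try_flip[OF wf t(1) v, of True]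
    note r1 = one[OF t v, of True]
    show ?case using greedy_inv_try_flip[OF wf t1 v, of False] one[OF t1 r1 v, of False]
      by (simp add: t_def c_def)
  qed (use inv rep in simp)
  from this[of "[0..<nverts G]"] show
    "represents G (greedy_pass G s) (pass_abs (nverts G) (length (edges G)) a)"
    "greedy_inv G r X0 Y N (greedy_pass G s)"
    by (auto simp: greedy_pass_def pass_abs_def atLeast0LessThan)
qed

lemma represents_passes:
  assumes wf: "wf_mgraph G" and inv: "greedy_inv G r X0 Y N s" and rep: "represents G s a"
  shows "represents G ((greedy_pass G ^^ (nverts G * nverts G)) s)
    (passes_abs (nverts G) (length (edges G)) a)"
proof -
  let ?H = "pass_abs (nverts G) (length (edges G))"
  have "greedy_inv G r X0 Y N ((greedy_pass G ^^ k) s) \<and> represents G ((greedy_pass G ^^ k) s) ((?H ^^ k) a)" for k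
  proof (induction k)
    case (Suc k)
    then have "greedy_inv G r X0 Y N ((greedy_pass G ^^ k) s)"
      "represents G ((greedy_pass G ^^ k) s) ((?H ^^ k) a)" by blast+
    from represents_pass[OF wf this] show ?case by simp
  qed (use inv rep in simp)
  moreover have "passes_abs (nverts G) (length (edges G)) = ?H ^^ (nverts G * nverts G)"
    by (simp add: passes_abs_def fold_const_upt funpow_mult)
  ultimately show ?thesis by simp
qed

section \<open>Polynomial running time\<close>

definition poly_time :: "(nat \<Rightarrow> nat) \<Rightarrow> bool" where
  "poly_time f \<longleftrightarrow> (\<exists>q :: nat poly. \<forall>x. poly q x = f x)"

text \<open>Equality with a polynomial, rather than a bound, is closed under sums and products and
  follows the syntax of the time expressions.\<close>

lemma poly_time_intros:
  "poly_time (\<lambda>x. x)" "poly_time (\<lambda>x. c)"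
  "poly_time f \<Longrightarrow> poly_time g \<Longrightarrow> poly_time (\<lambda>x. f x + g x)"
  "poly_time f \<Longrightarrow> poly_time g \<Longrightarrow> poly_time (\<lambda>x. f x * g x)"
proof -
  show "poly_time (\<lambda>x. x)" unfolding poly_time_def by (rule exI[of _ "[:0, 1:]"]) simp
  show "poly_time (\<lambda>x. c)" unfolding poly_time_def by (rule exI[of _ "[:c:]"]) simp
  show "poly_time f \<Longrightarrow> poly_time g \<Longrightarrow> poly_time (\<lambda>x. f x + g x)"
    unfolding poly_time_def by (metis poly_add)
  show "poly_time f \<Longrightarrow> poly_time g \<Longrightarrow> poly_time (\<lambda>x. f x * g x)"
    unfolding poly_time_def by (metis poly_mult)
qed

definition main_time :: "nat \<Rightarrow> nat \<Rightarrow> nat" where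
  "main_time n m = 4 + (read_time m + (6 + (relax_time n m + passes_time n m)))"

text \<open>One variable suffices: both numbers of vertices and edges will be bounded by the input
  size, and \<open>main_time\<close> is monotone.\<close>

lemma poly_time_main_time: "poly_time (\<lambda>x. main_time x x)"
  unfolding main_time_def read_time_def relax_time_def passes_time_def
  by (intro poly_time_intros)

lemma main_time_mono:
  assumes "n \<le> n'" "m \<le> m'"
  shows "main_time n m \<le> main_time n' m'"
  unfolding main_time_def read_time_def relax_time_def passes_time_def
  by (intro add_mono mult_le_mono assms order_refl)

lemma length_le_input_size: "length xs \<le> input_size xs"
  unfolding input_size_def by (induction xs) simp_all

lemma length_encode_instance:
  assumes "length X = length (edges G)" "length Y = length (edges G)"
  shows "length (encode_instance G r X Y) = 3 + 4 * length (edges G)"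
proof -
  have "length (concat (map (\<lambda>(u, v). [u, v]) E)) = 2 * length E" for E :: "(nat \<times> nat) list"
    by (induction E) auto
  then show ?thesis using assms by (simp add: encode_instance_def)
qed

theorem theorem6:
  "\<exists>(P :: ram_prog) (q :: nat poly).
     \<forall>(G :: mgraph) (vtop :: nat) (dir :: nat set \<Rightarrow> dart list) (c :: nat set \<Rightarrow> nat)
       (X :: orientation) (Y :: orientation).
       wf_mgraph G \<and> connected_mgraph G \<and> vtop < nverts G \<and> cycle_directions G dir \<and>
       c_orientation G dir c X \<and> c_orientation G dir c Y \<and>
       acyclic_orientation G X \<and> acyclic_orientation G Y \<longrightarrow>
       (\<exists>t vs. ram_computes P (encode_instance G vtop X Y) t vs \<and>
               t \<le> poly q (input_size (encode_instance G vtop X Y)) \<and>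
               shortest_flip_sequence G vtop X vs Y)"
proof -
  obtain q :: "nat poly" where q: "\<And>x. poly q x = main_time x x"
    using poly_time_main_time by (auto simp: poly_time_def)
  have "\<exists>t vs. ram_computes main_prog (encode_instance G r X Y) t vs \<and>
      t \<le> poly q (input_size (encode_instance G r X Y)) \<and> shortest_flip_sequence G r X vs Y"
    if wf: "wf_mgraph G" and con: "connected_mgraph G" and r: "r < nverts G" and dir: "cycle_directions G dir"
      and c: "c_orientation G dir c X" "c_orientation G dir c Y" and ac: "acyclic_orientation G X"
    for G r dir c X Y
  proof -
    let ?n = "nverts G" and ?m = "length (edges G)"
    have len: "length X = ?m" "length Y = ?m" using c by (simp_all add: c_orientation_def is_orientation_def)
    have rk: "ranked G X" by (rule acyclic_orientation_ranked[OF wf ac])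
    obtain z where pot: "potential G X Y z" and zr: "z r = 0"
      and z: "\<And>v. v < ?n \<Longrightarrow> \<bar>z v\<bar> < int ?n"
      by (rule potential_exists[OF wf con r walk_gain_cycle_traversal[OF dir c]]) blast+
    define xs :: "nat list" where
      "xs = concat (map (\<lambda>(u, v). [u, v]) (edges G)) @ map of_bool X @ map of_bool Y"
    have enc: "encode_instance G r X Y = ?n # ?m # r # xs" by (simp add: encode_instance_def xs_def)
    obtain A where A: "input_abs ?m xs = (A, [], [])"
      "\<And>e. e < ?m \<Longrightarrow> A 0 e = fst (edges G ! e) \<and> A 1 e = snd (edges G ! e) \<and>
         A 2 e = of_bool (X ! e) \<and> A 3 e = of_bool (Y ! e)"
      "\<And>v. A 4 v = 0"
      by (rule input_abs_encode[OF len, folded xs_def]) blast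
    define a where "a = root_abs ?n r (input_abs ?m xs)"
    have "relax_inv G X Y z a" "known a r"
      using A r zr by (simp_all add: a_def del: One_nat_def)
    note relaxed = relax_all[OF wf con pot _ this(1) r this(2)]
    define b where "b = relax_all_abs ?n ?m a"
    have b: "relax_inv G X Y z b" "\<And>v. v < ?n \<Longrightarrow> known b v"
      using relaxed z by (simp_all add: b_def)
    have rep: "represents G (X, z, []) b"
    proof (cases b)
      case (fields B i out)
      \<comment> \<open>All vertices are known after the relaxation, which rules out the alternative
        that the entry is still 0.\<close>
      have "int (B 4 v) = z v + int ?n" if "v < ?n" for v
        using b(1) b(2)[OF that] that by (auto simp: fields)
      with b(1) show ?thesis by (simp add: fields del: One_nat_def)
    qed
    have inv: "greedy_inv G r X Y (remaining G (X, z, [])) (X, z, [])"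
      using len rk pot zr z by simp
    obtain X' z' ws where fin: "(greedy_pass G ^^ (?n * ?n)) (X, z, []) = (X', z', ws)"
      by (metis prod_cases3)
    from represents_passes[OF wf inv rep] have "snd (snd (passes_abs ?n ?m b)) = ws"
      unfolding fin by (cases "passes_abs ?n ?m b") simp
    then obtain t where t: "ram_computes main_prog (encode_instance G r X Y) t ws" "t \<le> main_time ?n ?m"
      using main_prog_correct[of ?n ?m r xs] by (auto simp: enc main_time_def b_def a_def)
    \<comment> \<open>The edge list and the orientations occupy one number per entry, so the input
      size dominates m and, through the bound 2 m + 1, also n.\<close>
    have "3 + 4 * ?m \<le> input_size (encode_instance G r X Y)"
      using length_le_input_size[of "encode_instance G r X Y"] length_encode_instance[OF len] by simp
    with nverts_le_edges[OF wf con] have "t \<le> poly q (input_size (encode_instance G r X Y))"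
      unfolding q by (intro order_trans[OF t(2) main_time_mono]) simp_all
    with t(1) greedy_shortest[OF wf con r len rk pot zr z fin] show ?thesis by blast
  qed
  then show ?thesis by blast
qed

end
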